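(* Let $0<\beta<1$, $0\le\alpha<n$, $0<\alpha+\beta<n$, $b\in L^1_{\rm loc}(\mathbb{R}^n)$, let $\Phi,\Psi$ be Young functions and $\Phi\in\mathcal{Y}$. 1. Suppose there is a constant $C>0$ such that $t^{-\frac{\alpha+\beta}{n}}\Phi^{-1}(t)\le C\,\Psi^{-1}(t)$ for all $t>0$. Then the condition $b\in\dot\Lambda_\beta(\mathbb{R}^n)$ is sufficient for the boundedness of $M_{b,\alpha}$ from $L^\Phi(\mathbb{R}^n)$ to $WL^\Psi(\mathbb{R}^n)$. 2. Suppose there is a constant $C>0$ such that $\Psi^{-1}(t)\le C\,\Phi^{-1}(t)\,t^{-\frac{\alpha+\beta}{n}}$ for all $t>0$, and that $\frac{t^{1+\varepsilon}}{\Psi(t)}$ is almost decreasing for some $\varepsilon>0$. Then the condition $b\in\dot\Lambda_\beta(\mathbb{R}^n)$ is necessary for the boundedness of $M_{b,\alpha}$ from $L^\Phi(\mathbb{R}^n)$ to $WL^\Psi(\mathbb{R}^n)$. 3. Suppose there are constants $C_1,C_2>0$ such that $C_1\Phi^{-1}(t)t^{-\frac{\alpha+\beta}{n}}\le\Psi^{-1}(t)\le C_2\Phi^{-1}(t)t^{-\frac{\alpha+\beta}{n}}$ for all $t>0$, and that $\frac{t^{1+\varepsilon}}{\Psi(t)}$ is almost decreasing for some $\varepsilon>0$. Then the condition $b\in\dot\Lambda_\beta(\mathbb{R}^n)$ is necessary and sufficient for the boundedness of $M_{b,\alpha}$ from $L^\Phi(\mathbb{R}^n)$ to $WL^\Ps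i(\mathbb{R}^n)$.
   Context: A Young function is a convex, left-continuous function $\Phi:[0,\infty)\to[0,\infty]$ with $\lim_{r\to0+}\Phi(r)=\Phi(0)=0$ and $\lim_{r\to\infty}\Phi(r)=\infty$. $\mathcal{Y}$ is the set of Young functions with $0<\Phi(r)<\infty$ for all $0<r<\infty$. For a Young function, $\Phi^{-1}(s)=\inf\{r\ge0:\Phi(r)>s\}$. A function $g:(0,\infty)\to[0,\infty]$ is almost decreasing if there is a constant $C>0$ with $g(s)\le C\,g(t)$ whenever $s\ge t>0$. The Orlicz space $L^\Phi(\mathbb{R}^n)$ is the set of $f\in L^1_{\rm loc}(\mathbb{R}^n)$ with $\int_{\mathbb{R}^n}\Phi(k|f(x)|)\,dx<\infty$ for some $k>0$, with norm $\|f\|_{L^\Phi}=\inf\{\lambda>0:\int_{\mathbb{R}^n}\Phi(|f(x)|/\lambda)\,dx\le1\}$. The weak Orlicz space $WL^\Phi(\mathbb{R}^n)$ is the set of $f\in L^1_{\rm loc}(\mathbb{R}^n)$ with $\|f\|_{WL^\Phi}<\infty$, where $\|f\|_{WL^\Phi}=\inf\{\lambda>0:\sup_{t>0}\Phi(t)\,|\{x\in\mathbb{R}^n:|f(x)|/\lambda>t\}|\le1\}$ ($|E|$ is Lebesgue measure; $\infty\cdot0=0$). The fractional maximal commutator is $M_{b,\alpha}f(x)=\sup_{B\ni x}|B|^{-1+\frac{\alpha}{n}}\int_B|b(x)-b(y)||f(y)|\,dy$, the supremum being over all balls $B\subset\mathbb{R}^n$ containing $x$. An operator $T$ is bounded from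 $X$ to $Y$ if there is a constant $C$ with $\|Tf\|_Y\le C\|f\|_X$ for all $f\in X$. For $0<\beta<1$, $b\in\dot\Lambda_\beta(\mathbb{R}^n)$ (Lipschitz space) means there is a constant $C$ with $|b(x)-b(y)|\le C|x-y|^\beta$ for all $x,y\in\mathbb{R}^n$ (for a locally integrable $b$, understood up to modification on a null set). *)

theory Defs
  imports "HOL-Analysis.Analysis"
begin

text \<open>
  Functions from \<open>[0,\<infinity>)\<close> to \<open>[0,\<infinity>]\<close> have type \<^typ>\<open>real \<Rightarrow> ennreal\<close>;
  values at negative arguments are never used. In \<^typ>\<open>ennreal\<close>, \<open>\<infinity> * 0 = 0\<close>.
\<close>

definition young_function :: "(real \<Rightarrow> ennreal) \<Rightarrow> bool" where
  "young_function \<Phi> \<longleftrightarrow>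
     (\<forall>r\<ge>0. \<forall>s\<ge>0. \<forall>u\<in>{0..1}.
        \<Phi> (u * r + (1 - u) * s) \<le> ennreal u * \<Phi> r + ennreal (1 - u) * \<Phi> s) \<and>
     (\<forall>r>0. (\<Phi> \<longlongrightarrow> \<Phi> r) (at_left r)) \<and>
     \<Phi> 0 = 0 \<and>
     (\<Phi> \<longlongrightarrow> 0) (at_right 0) \<and>
     (\<Phi> \<longlongrightarrow> \<infinity>) at_top"

definition young_class_Y :: "(real \<Rightarrow> ennreal) set" where
  "young_class_Y = {\<Phi>. young_function \<Phi> \<and> (\<forall>r>0. 0 < \<Phi> r \<and> \<Phi> r < \<infinity>)}"

text \<open>
  For a Young function and \<open>0 \<le> s < \<infinity>\<close> the set below is nonempty, because \<open>\<Phi>\<close> tends to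
  infinity, so the infimum over the reals is the intended one.
\<close>

definition young_inverse :: "(real \<Rightarrow> ennreal) \<Rightarrow> real \<Rightarrow> real" where
  "young_inverse \<Phi> s = Inf {r. 0 \<le> r \<and> ennreal s < \<Phi> r}"

definition almost_decreasing :: "(real \<Rightarrow> ennreal) \<Rightarrow> bool" where
  "almost_decreasing g \<longleftrightarrow> (\<exists>C>0. \<forall>s t. s \<ge> t \<and> t > 0 \<longrightarrow> g s \<le> ennreal C * g t)"

definition L1_loc :: "(real ^ 'n \<Rightarrow> real) set" where
  "L1_loc = {f. \<forall>K. compact K \<longrightarrow> f absolutely_integrable_on K}"

definition orlicz_space :: "(real \<Rightarrow> ennreal) \<Rightarrow> (real ^ 'n \<Rightarrow> real) set" where
  "orlicz_space \<Phi> =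
     {f \<in> L1_loc. \<exists>k>0. (\<integral>\<^sup>+ x. \<Phi> (k * \<bar>f x\<bar>) \<partial>lebesgue) < \<infinity>}"

definition orlicz_norm :: "(real \<Rightarrow> ennreal) \<Rightarrow> (real ^ 'n \<Rightarrow> real) \<Rightarrow> ennreal" where
  "orlicz_norm \<Phi> f =
     Inf (ennreal ` {l. 0 < l \<and> (\<integral>\<^sup>+ x. \<Phi> (\<bar>f x\<bar> / l) \<partial>lebesgue) \<le> 1})"

text \<open>
  The weak Orlicz norm depends on a function only through its absolute value. It is given here
  for that absolute value, as a \<open>[0,\<infinity>]\<close>-valued function, since the maximal commutator
  may take the value \<open>\<infinity>\<close>.
\<close>

definition weak_orlicz_norm :: "(real \<Rightarrow> ennreal) \<Rightarrow> (real ^ 'n \<Rightarrow> ennreal) \<Rightarrow> ennreal" where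
  "weak_orlicz_norm \<Phi> g =
     Inf (ennreal ` {l. 0 < l \<and>
       (SUP t\<in>{0<..}. \<Phi> t * emeasure lebesgue {x. g x / ennreal l > ennreal t}) \<le> 1})"

definition frac_max_commutator ::
    "(real ^ 'n \<Rightarrow> real) \<Rightarrow> real \<Rightarrow> (real ^ 'n \<Rightarrow> real) \<Rightarrow> real ^ 'n \<Rightarrow> ennreal" where
  "frac_max_commutator b \<alpha> f x =
     (SUP B\<in>{ball c r | c r. x \<in> ball c r}.
        ennreal (measure lebesgue B powr (- 1 + \<alpha> / real CARD('n))) *
        (\<integral>\<^sup>+ y\<in>B. ennreal (\<bar>b x - b y\<bar> * \<bar>f y\<bar>) \<partial>lebesgue))"

definition bounded_orlicz_to_weak ::
    "(real \<Rightarrow> ennreal) \<Rightarrow> (real \<Rightarrow> ennreal) \<Rightarrow>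
     ((real ^ 'n \<Rightarrow> real) \<Rightarrow> real ^ 'n \<Rightarrow> ennreal) \<Rightarrow> bool" where
  "bounded_orlicz_to_weak \<Phi> \<Psi> T \<longleftrightarrow>
     (\<exists>C::real. \<forall>f\<in>orlicz_space \<Phi>.
        weak_orlicz_norm \<Psi> (T f) \<le> ennreal C * orlicz_norm \<Phi> f)"

definition lipschitz_space :: "real \<Rightarrow> (real ^ 'n \<Rightarrow> real) set" where
  "lipschitz_space \<beta> =
     {b. \<exists>b'. (AE x in lebesgue. b x = b' x) \<and>
         (\<exists>C. \<forall>x y. \<bar>b' x - b' y\<bar> \<le> C * norm (x - y) powr \<beta>)}"

end

theory Submission
  imports Defs
begin

text \<open>
  Sufficiency: a Lipschitz \<open>b\<close> makes the commutator pointwise a.e. bounded by a multiple of the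
  fractional maximal function of order \<open>\<alpha> + \<beta>\<close>. If \<open>\<integral> \<Phi>(|f|) \<le> 1\<close> and a ball \<open>B\<close> satisfies
  \<open>|B| powr ((\<alpha>+\<beta>)/n - 1) * \<integral>\<^sub>B |f| > t\<close>, then comparing \<open>|f|\<close> with \<open>\<Phi>\<^sup>-\<^sup>1(m)\<close>, where \<open>m\<close> is the mean of
  \<open>\<Phi>(|f|)\<close> over \<open>B\<close>, and using \<open>m \<le> 1/|B|\<close> gives \<open>\<Psi>(t/4C) |B| \<le> \<integral>\<^sub>B \<Phi>(|f|)\<close>. The Vitali
  covering lemma sums these inequalities to the weak type bound.

  Necessity: test on the indicator function of a ball \<open>B\<close>. With \<open>T = 2 \<Psi>\<^sup>-\<^sup>1(1/|B|)\<close> the weak bound shows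
  that the set where the commutator exceeds \<open>T\<close> times (roughly) its weak norm has measure less than \<open>|B|\<close>, so it misses some
  \<open>x \<in> B\<close>, and this single point already yields \<open>\<integral>\<^sub>B |b - b(x)| \<le> A r\<^sup>\<beta> |B|\<close>. By a Campanato argument
  the approximating constants of the balls around a point converge as the radius shrinks; their
  limit is Hoelder continuous and agrees with \<open>b\<close> a.e., because the \<open>L\<^sup>1\<close> distance on a ball, covered
  by balls of radius \<open>d\<close>, is \<open>O(d\<^sup>\<beta>)\<close>.
\<close>

section \<open>Young functions\<close>

lemma young_function_scale_le:
  assumes "young_function \<Phi>" "0 \<le> u" "u \<le> 1" "0 \<le> r"
  shows "\<Phi> (u * r) \<le> ennreal u * \<Phi> r"
proof -
  have "\<Phi> (u * r + (1 - u) * 0) \<le> ennreal u * \<Phi> r + ennreal (1 - u) * \<Phi> 0"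
    using assms unfolding young_function_def by (meson atLeastAtMost_iff order_refl)
  then show ?thesis
    using assms by (simp add: young_function_def)
qed

lemma young_function_mono:
  assumes "young_function \<Phi>" "0 \<le> r" "r \<le> s"
  shows "\<Phi> r \<le> \<Phi> s"
proof (cases "s = 0")
  case False
  with assms have s: "0 < s" by simp
  have "\<Phi> (r / s * s) \<le> ennreal (r / s) * \<Phi> s"
    using assms s by (intro young_function_scale_le) auto
  also have "\<dots> \<le> 1 * \<Phi> s"
    using assms s by (intro mult_right_mono) auto
  finally show ?thesis using s by simp
qed (use assms in auto)

lemma young_inverse_le:
  assumes "0 \<le> r" "ennreal s < \<Phi> r"
  shows "young_inverse \<Phi> s \<le> r"
  unfolding young_inverse_def using assms by (intro cInf_lower) (auto intro: bdd_belowI)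

lemma le_of_less_young_inverse:
  assumes "0 \<le> r" "r < young_inverse \<Phi> s"
  shows "\<Phi> r \<le> ennreal s"
  using young_inverse_le[of r s \<Phi>] assms by force

text \<open>Since \<Phi> tends to infinity, the infimum is over a nonempty set, so a point of that
  set lies below \<open>r\<close>, and monotonicity does the rest. At the infimum itself
  left-continuity gives the opposite weak inequality; hence later arguments evaluate at twice the
  inverse.\<close>

lemma less_of_young_inverse_less:
  assumes "young_function \<Phi>" "young_inverse \<Phi> s < r"
  shows "ennreal s < \<Phi> r"
proof -
  have "eventually (\<lambda>x. ennreal s < \<Phi> x) at_top"
    using assms(1) unfolding young_function_def by (intro order_tendstoD(1)[of _ \<infinity>]) auto
  then have "eventually (\<lambda>x. ennreal s < \<Phi> x \<and> 0 \<le> x) at_top"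
    using eventually_ge_at_top[of "0::real"] by eventually_elim auto
  then have ne: "{r. 0 \<le> r \<and> ennreal s < \<Phi> r} \<noteq> {}"
    by (auto simp: eventually_at_top_linorder)
  obtain x where "0 \<le> x" "ennreal s < \<Phi> x" "x < r"
    using assms(2) cInf_lessD[OF ne] unfolding young_inverse_def by auto
  with young_function_mono[OF assms(1), of x r] show ?thesis by force
qed

lemma young_inverse_pos:
  assumes "young_function \<Phi>" "0 < s"
  shows "0 < young_inverse \<Phi> s"
proof -
  have "eventually (\<lambda>x. \<Phi> x < ennreal s) (at_right 0)"
    using assms unfolding young_function_def by (intro order_tendstoD(2)[of _ 0]) auto
  then obtain d where d: "0 < d" "\<And>x. 0 < x \<Longrightarrow> x < d \<Longrightarrow> \<Phi> x < ennreal s"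
    by (auto simp: eventually_at_right_field)
  have "\<not> young_inverse \<Phi> s < d / 2"
    using less_of_young_inverse_less[OF assms(1), of s "d/2"] d(2)[of "d/2"] d(1) by force
  with d(1) show ?thesis by simp
qed

lemma borel_measurable_young_abs:
  assumes "\<Phi> \<in> young_class_Y" and [measurable]: "f \<in> borel_measurable M"
  shows "(\<lambda>x. \<Phi> \<bar>f x :: real\<bar>) \<in> borel_measurable M"
proof -
  have Y: "young_function \<Phi>" using assms(1) by (simp add: young_class_Y_def)
  have fin: "\<Phi> r < \<infinity>" if "0 \<le> r" for r
  proof (cases "r = 0")
    case True
    then show ?thesis using Y by (simp add: young_function_def)
  next
    case False
    then show ?thesis using assms(1) that by (simp add: young_class_Y_def)
  qed
  \<comment> \<open>Values at negative arguments are arbitrary, so \<open>max 0\<close> is what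
    makes \<open>\<phi>\<close> monotone on the whole line; finiteness makes \<open>enn2real\<close>
    lossless.\<close>
  define \<phi> where "\<phi> x = enn2real (\<Phi> (max 0 x))" for x
  have "mono \<phi>"
  proof (rule monoI)
    fix x y :: real assume "x \<le> y"
    then show "\<phi> x \<le> \<phi> y"
      unfolding \<phi>_def using young_function_mono[OF Y, of "max 0 x" "max 0 y"] fin[of "max 0 y"]
      by (intro enn2real_mono) auto
  qed
  then have [measurable]: "\<phi> \<in> borel_measurable borel" by (rule borel_measurable_mono)
  have "\<Phi> \<bar>f x\<bar> = ennreal (\<phi> \<bar>f x\<bar>)" for x
    using fin[of "\<bar>f x\<bar>"] by (simp add: \<phi>_def)
  then show ?thesis by simp
qed

section \<open>Vitali coverings\<close>

text \<open>A countable disjoint subfamily has fivefold dilates that cover the union. Subadditivity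
  of \<mu> on the dilates and additivity of \<nu> on the disjoint balls carry the inequality from
  single balls to the union. It serves twice: for the weak type bound and for a.e. equality in the
  Campanato argument.\<close>

lemma Vitali_emeasure_le:
  fixes a :: "'i \<Rightarrow> 'b::euclidean_space" and c :: ennreal
  assumes r: "\<And>i. i \<in> K \<Longrightarrow> 0 < r i \<and> r i \<le> R"
    and sets: "sets \<mu> = sets lebesgue" "sets \<nu> = sets lebesgue"
    and le: "\<And>i. i \<in> K \<Longrightarrow> emeasure \<mu> (ball (a i) (5 * r i)) \<le> c * emeasure \<nu> (ball (a i) (r i))"
  shows "emeasure \<mu> (\<Union>i\<in>K. ball (a i) (r i)) \<le> c * emeasure \<nu> (\<Union>i\<in>K. ball (a i) (r i))"
proof -
  obtain C where C: "countable C" "C \<subseteq> K"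
     "pairwise (\<lambda>i j. disjnt (ball (a i) (r i)) (ball (a j) (r j))) C"
     "(\<Union>i\<in>K. ball (a i) (r i)) \<subseteq> (\<Union>i\<in>C. ball (a i) (5 * r i))"
    by (rule Vitali_covering_lemma_balls[OF order_refl r])
  \<comment> \<open>The subfamily may be finite, so it is enumerated as a sequence padded with empty
    sets, to which the \<open>suminf\<close> rules apply.\<close>
  define N where "N = to_nat_on C ` C"
  define idx where "idx = from_nat_into C"
  define A where "A n = (if n \<in> N then ball (a (idx n)) (r (idx n)) else {})" for n
  define B where "B n = (if n \<in> N then ball (a (idx n)) (5 * r (idx n)) else {})" for n
  have idx: "idx (to_nat_on C i) = i" if "i \<in> C" for i
    using that C(1) by (simp add: idx_def)
  have idxC: "idx n \<in> C" if "n \<in> N" for n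
    using that by (auto simp: N_def idx)
  have AB [measurable]: "A n \<in> sets lebesgue" "B n \<in> sets lebesgue" for n
    by (auto simp: A_def B_def)
  have UA: "(\<Union>n. A n) \<subseteq> (\<Union>i\<in>K. ball (a i) (r i))"
    using idxC C(2) by (fastforce simp: A_def split: if_splits)
  have UB: "(\<Union>i\<in>K. ball (a i) (r i)) \<subseteq> (\<Union>n. B n)"
  proof
    fix x assume "x \<in> (\<Union>i\<in>K. ball (a i) (r i))"
    then obtain i where i: "i \<in> C" "x \<in> ball (a i) (5 * r i)" using C(4) by blast
    then have "x \<in> B (to_nat_on C i)" using idx by (auto simp: B_def N_def)
    then show "x \<in> (\<Union>n. B n)" by blast
  qed
  have dis: "disjoint_family A"
    unfolding disjoint_family_on_def
  proof (intro ballI impI)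
    fix m n :: nat assume "m \<noteq> n"
    have "idx m \<noteq> idx n" if "m \<in> N" "n \<in> N"
      using that \<open>m \<noteq> n\<close> by (auto simp: N_def idx)
    then show "A m \<inter> A n = {}"
      using C(3) idxC unfolding A_def pairwise_def disjnt_def by auto
  qed
  \<comment> \<open>The index set \<open>K\<close> may be uncountable; measurability of the union
    comes from openness.\<close>
  have op: "(\<Union>i\<in>K. ball (a i) (r i)) \<in> sets lebesgue"
    by (intro sets_completionI_sets) (auto intro: borel_open)
  have "emeasure \<mu> (\<Union>i\<in>K. ball (a i) (r i)) \<le> emeasure \<mu> (\<Union>n. B n)"
    using UB by (intro emeasure_mono) (auto simp: sets)
  also have "\<dots> \<le> (\<Sum>n. emeasure \<mu> (B n))"
    by (intro emeasure_subadditive_countably) (auto simp: sets)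
  also have "\<dots> \<le> (\<Sum>n. c * emeasure \<nu> (A n))"
    using le idxC C(2) by (intro suminf_le) (auto simp: A_def B_def subset_iff)
  also have "\<dots> = c * (\<Sum>n. emeasure \<nu> (A n))"
    by (rule ennreal_suminf_cmult)
  also have "(\<Sum>n. emeasure \<nu> (A n)) = emeasure \<nu> (\<Union>n. A n)"
    using dis by (intro suminf_emeasure) (auto simp: sets)
  also have "c * \<dots> \<le> c * emeasure \<nu> (\<Union>i\<in>K. ball (a i) (r i))"
    using UA op by (intro mult_left_mono emeasure_mono) (auto simp: sets)
  finally show ?thesis .
qed

section \<open>Sufficiency\<close>

text \<open>The function is the pointwise limit of its truncations to the balls
  \<open>cball 0 k\<close>, each measurable by integrability there.\<close>

lemma L1_loc_borel_measurable:
  fixes f :: "real ^ 'n \<Rightarrow> real"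
  assumes "f \<in> L1_loc"
  shows "f \<in> borel_measurable lebesgue"
proof (rule borel_measurable_LIMSEQ_metric)
  fix k :: nat
  have "f absolutely_integrable_on cball 0 (real k)"
    using assms by (auto simp: L1_loc_def)
  then show "(\<lambda>x. if x \<in> cball 0 (real k) then f x else 0) \<in> borel_measurable lebesgue"
    by (subst borel_measurable_if) (auto intro: absolutely_integrable_measurable[THEN iffD1, THEN conjunct1])
next
  fix x :: "real ^ 'n"
  have "eventually (\<lambda>k. norm x \<le> real k) sequentially"
    by (rule eventually_sequentiallyI[of "nat \<lceil>norm x\<rceil>"]) (simp add: nat_ceiling_le_eq)
  then have "eventually (\<lambda>k. (if x \<in> cball 0 (real k) then f x else 0) = f x) sequentially"
    by eventually_elim auto
  then show "(\<lambda>k. if x \<in> cball 0 (real k) then f x else 0) \<longlonglongrightarrow> f x"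
    by (rule tendsto_eventually)
qed

section \<open>Weak type bound for the fractional maximal function\<close>

text \<open>A substitute for Jensen's inequality at the price of a factor 2. Where
  \<open>\<bar>f x\<bar>\<close> exceeds \<open>a\<close>, convexity and \<open>\<Phi> 0 = 0\<close>
  make \<open>\<Phi> r / r\<close> at \<open>a\<close> at most its value at
  \<open>\<bar>f x\<bar>\<close>; elsewhere \<open>a\<close> itself bounds
  \<open>\<bar>f x\<bar>\<close>. Adding both bounds gives \<open>pt\<close>, which is
  integrated.\<close>

lemma set_nn_integral_abs_le_young:
  assumes \<Phi>: "\<Phi> \<in> young_class_Y"
    and f [measurable]: "f \<in> borel_measurable M" and B [measurable]: "B \<in> sets M"
    and "0 < a" and le: "(\<integral>\<^sup>+x\<in>B. \<Phi> \<bar>f x :: real\<bar> \<partial>M) \<le> \<Phi> a * emeasure M B"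
  shows "(\<integral>\<^sup>+x\<in>B. ennreal \<bar>f x\<bar> \<partial>M) \<le> ennreal (2 * a) * emeasure M B"
proof -
  have Y: "young_function \<Phi>" and \<Phi>a: "0 < \<Phi> a" "\<Phi> a < \<infinity>"
    using \<Phi> \<open>0 < a\<close> by (auto simp: young_class_Y_def)
  note [measurable] = borel_measurable_young_abs[OF \<Phi> f]
  have pt: "\<Phi> a * ennreal \<bar>f x\<bar> \<le> ennreal a * \<Phi> a + ennreal a * \<Phi> \<bar>f x\<bar>" for x
  proof (cases "\<bar>f x\<bar> \<le> a")
    case True
    then have "\<Phi> a * ennreal \<bar>f x\<bar> \<le> \<Phi> a * ennreal a"
      by (intro mult_left_mono) auto
    then show ?thesis by (metis add_increasing2 mult.commute zero_le)
  next
    case False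
    then have fx: "0 < \<bar>f x\<bar>" using \<open>0 < a\<close> by linarith
    have "\<Phi> (a / \<bar>f x\<bar> * \<bar>f x\<bar>) \<le> ennreal (a / \<bar>f x\<bar>) * \<Phi> \<bar>f x\<bar>"
      using False \<open>0 < a\<close> fx by (intro young_function_scale_le[OF Y]) auto
    then have "\<Phi> a \<le> ennreal (a / \<bar>f x\<bar>) * \<Phi> \<bar>f x\<bar>" using fx by simp
    then have "\<Phi> a * ennreal \<bar>f x\<bar> \<le> ennreal (a / \<bar>f x\<bar>) * \<Phi> \<bar>f x\<bar> * ennreal \<bar>f x\<bar>"
      by (rule mult_right_mono) simp
    also have "\<dots> = ennreal (a / \<bar>f x\<bar>) * ennreal \<bar>f x\<bar> * \<Phi> \<bar>f x\<bar>"
      by (simp add: mult_ac)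
    also have "ennreal (a / \<bar>f x\<bar>) * ennreal \<bar>f x\<bar> = ennreal a"
      using fx \<open>0 < a\<close> by (simp flip: ennreal_mult)
    finally show ?thesis by (simp add: add_increasing)
  qed
  have "\<Phi> a * (\<integral>\<^sup>+x\<in>B. ennreal \<bar>f x\<bar> \<partial>M) = (\<integral>\<^sup>+x\<in>B. \<Phi> a * ennreal \<bar>f x\<bar> \<partial>M)"
    by (simp add: nn_integral_cmult[symmetric] mult.assoc)
  also have "\<dots> \<le> (\<integral>\<^sup>+x\<in>B. (ennreal a * \<Phi> a + ennreal a * \<Phi> \<bar>f x\<bar>) \<partial>M)"
    by (intro nn_integral_mono mult_right_mono pt) auto
  also have "\<dots> = (\<integral>\<^sup>+x. ennreal a * \<Phi> a * indicator B x + ennreal a * (\<Phi> \<bar>f x\<bar> * indicator B x) \<partial>M)"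
    by (simp add: distrib_right mult.assoc)
  also have "\<dots> = ennreal a * \<Phi> a * emeasure M B + ennreal a * (\<integral>\<^sup>+x\<in>B. \<Phi> \<bar>f x\<bar> \<partial>M)"
    by (subst nn_integral_add) (auto simp: nn_integral_cmult)
  also have "\<dots> \<le> ennreal a * \<Phi> a * emeasure M B + ennreal a * (\<Phi> a * emeasure M B)"
    by (intro add_left_mono mult_left_mono le) auto
  also have "\<dots> = \<Phi> a * ((ennreal a + ennreal a) * emeasure M B)"
    by (simp add: algebra_simps)
  also have "ennreal a + ennreal a = ennreal (2 * a)"
    using \<open>0 < a\<close> by (simp flip: ennreal_plus)
  \<comment> \<open>Cancelling \<open>\<Phi> a\<close> requires it to be positive and finite, as
    membership in the class guarantees.\<close>
  finally show ?thesis
    using \<Phi>a by (simp add: ennreal_mult_le_mult_iff)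
qed

text \<open>In the divisor \<open>4 * C\<close>, one factor 2 comes from the Jensen substitute,
  another from evaluating at twice the inverse, and \<open>C\<close> from comparing the two
  inverses. In the application \<open>\<theta>\<close> is
  \<open>(\<alpha> + \<beta>) / n\<close>.\<close>

lemma young_emeasure_le_of_less_average:
  assumes \<Phi>: "\<Phi> \<in> young_class_Y" and \<Psi>: "young_function \<Psi>" and "0 < C" "0 \<le> \<theta>"
    and inv: "\<And>t. 0 < t \<Longrightarrow> t powr (- \<theta>) * young_inverse \<Phi> t \<le> C * young_inverse \<Psi> t"
    and f [measurable]: "f \<in> borel_measurable M" and B [measurable]: "B \<in> sets M"
    and one: "(\<integral>\<^sup>+x\<in>B. \<Phi> \<bar>f x :: real\<bar> \<partial>M) \<le> 1"
    and v: "0 < v" "emeasure M B = ennreal v"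
    and "0 < t" and less: "ennreal t < ennreal (v powr (- 1 + \<theta>)) * (\<integral>\<^sup>+x\<in>B. ennreal \<bar>f x\<bar> \<partial>M)"
  shows "\<Psi> (t / (4 * C)) * emeasure M B \<le> (\<integral>\<^sup>+x\<in>B. \<Phi> \<bar>f x\<bar> \<partial>M)"
proof -
  have Y: "young_function \<Phi>"
    using \<Phi> by (auto simp: young_class_Y_def)
  define i where "i = enn2real (\<integral>\<^sup>+x\<in>B. \<Phi> \<bar>f x\<bar> \<partial>M)"
  have "(\<integral>\<^sup>+x\<in>B. \<Phi> \<bar>f x\<bar> \<partial>M) < top" using one by (rule order_le_less_trans) simp
  then have i: "(\<integral>\<^sup>+x\<in>B. \<Phi> \<bar>f x\<bar> \<partial>M) = ennreal i" "0 \<le> i"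
    by (simp_all add: i_def)
  have i1: "i \<le> 1" using one i by simp
  define m where "m = i / v"
  have iv: "i = m * v" "0 \<le> m" using v i by (auto simp: m_def)
  \<comment> \<open>Applied twice: with a small \<open>a\<close> to exclude a vanishing mean
    \<open>m\<close>, then with twice the inverse of \<Phi> at \<open>m\<close>.\<close>
  have key: "t < 2 * a * v powr \<theta>" if "0 < a" "ennreal m < \<Phi> a" for a
  proof -
    have "(\<integral>\<^sup>+x\<in>B. \<Phi> \<bar>f x\<bar> \<partial>M) = ennreal m * emeasure M B"
      using v iv i by (simp add: ennreal_mult)
    also have "\<dots> \<le> \<Phi> a * emeasure M B"
      using that by (intro mult_right_mono) auto
    finally have *: "(\<integral>\<^sup>+x\<in>B. ennreal \<bar>f x\<bar> \<partial>M) \<le> ennreal (2 * a) * emeasure M B"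
      by (rule set_nn_integral_abs_le_young[OF \<Phi> f B \<open>0 < a\<close>])
    have "ennreal t < ennreal (v powr (- 1 + \<theta>)) * (ennreal (2 * a) * ennreal v)"
      using less_le_trans[OF less mult_left_mono[OF *]] v by simp
    also have "\<dots> = ennreal (v powr (- 1 + \<theta>) * (2 * a * v))"
      using that v by (simp add: ennreal_mult)
    also have "v powr (- 1 + \<theta>) * (2 * a * v) = 2 * a * v powr \<theta>"
      using v by (simp add: powr_diff field_simps)
    finally show ?thesis
      using \<open>0 < t\<close> by (simp add: ennreal_less_iff)
  qed
  \<comment> \<open>For \<open>m = 0\<close> every positive \<open>a\<close> is admissible, and the
    chosen one turns \<open>key\<close> into \<open>t < t\<close>.\<close>
  have "m \<noteq> 0"
  proof
    assume "m = 0"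
    have "t < 2 * (t / (2 * v powr \<theta>)) * v powr \<theta>"
      using \<open>0 < t\<close> v \<Phi> \<open>m = 0\<close> by (intro key) (auto simp: young_class_Y_def)
    then show False using v by simp
  qed
  with iv have m: "0 < m" by simp
  have pos: "0 < young_inverse \<Phi> m" by (rule young_inverse_pos[OF Y m])
  have "t < 2 * (2 * young_inverse \<Phi> m) * v powr \<theta>"
    using pos by (intro key less_of_young_inverse_less[OF Y]) auto
  \<comment> \<open>The normalization \<open>i \<le> 1\<close> says \<open>v \<le> 1 / m\<close>;
    this produces the power of \<open>m\<close> that occurs in \<open>inv\<close>.\<close>
  also have "v powr \<theta> \<le> (1 / m) powr \<theta>"
    using v m i1 iv \<open>0 \<le> \<theta>\<close> by (intro powr_mono2) (auto simp: field_simps)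
  also have "(1 / m) powr \<theta> = m powr (- \<theta>)"
    using m by (simp add: powr_minus powr_divide field_simps)
  also have "2 * (2 * young_inverse \<Phi> m) * m powr (- \<theta>) \<le> 4 * (C * young_inverse \<Psi> m)"
    using inv[OF m] by (simp add: mult_ac)
  finally have "t / (4 * C) < young_inverse \<Psi> m"
    using \<open>0 < C\<close> pos by (simp add: field_simps)
  then have "\<Psi> (t / (4 * C)) \<le> ennreal m"
    using \<open>0 < t\<close> \<open>0 < C\<close> by (intro le_of_less_young_inverse) auto
  then have "\<Psi> (t / (4 * C)) * emeasure M B \<le> ennreal m * ennreal v"
    unfolding v by (rule mult_right_mono) simp
  also have "\<dots> = (\<integral>\<^sup>+x\<in>B. \<Phi> \<bar>f x\<bar> \<partial>M)"
    using i iv v by (simp add: ennreal_mult)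
  finally show ?thesis .
qed

text \<open>The union is the superlevel set at \<open>t\<close> of the fractional maximal function
  of order \<open>n * \<theta>\<close>. The Vitali lemma is applied to \<open>p\<close> times
  Lebesgue measure and to the measure with density \<open>\<Phi> \<bar>f x\<bar>\<close>; the
  constant is the volume factor of the fivefold dilation.\<close>

lemma fractional_maximal_weak_bound:
  fixes f :: "real ^ 'n \<Rightarrow> real"
  assumes \<Phi>: "\<Phi> \<in> young_class_Y" and \<Psi>: "young_function \<Psi>" and "0 < C" "0 \<le> \<theta>"
    and inv: "\<And>t. 0 < t \<Longrightarrow> t powr (- \<theta>) * young_inverse \<Phi> t \<le> C * young_inverse \<Psi> t"
    and f [measurable]: "f \<in> borel_measurable lebesgue"
    and one: "(\<integral>\<^sup>+x. \<Phi> \<bar>f x\<bar> \<partial>lebesgue) \<le> 1" and "0 < t"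
  shows "\<Psi> (t / (4 * C)) * emeasure lebesgue (\<Union>(c, r)\<in>{(c, r). 0 < r \<and> ennreal t <
      ennreal (measure lebesgue (ball c r) powr (- 1 + \<theta>)) *
      (\<integral>\<^sup>+x\<in>ball c r. ennreal \<bar>f x\<bar> \<partial>lebesgue)}. ball c r)
    \<le> ennreal (5 ^ CARD('n))"
proof -
  define K where "K = {(c, r). 0 < r \<and> ennreal t <
      ennreal (measure lebesgue (ball c r) powr (- 1 + \<theta>)) *
      (\<integral>\<^sup>+x\<in>ball c r. ennreal \<bar>f x\<bar> \<partial>lebesgue)}"
  define p where "p = \<Psi> (t / (4 * C))"
  define V where "V = unit_ball_vol (real CARD('n))"
  have V: "0 < V" by (simp add: V_def)
  note [measurable] = borel_measurable_young_abs[OF \<Phi> f]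
  have le1: "(\<integral>\<^sup>+x\<in>B. \<Phi> \<bar>f x\<bar> \<partial>lebesgue) \<le> 1" for B
    by (rule order_trans[OF nn_integral_mono one]) (auto simp: indicator_def)
  have ball_le: "p * emeasure lebesgue (ball c r) \<le> (\<integral>\<^sup>+x\<in>ball c r. \<Phi> \<bar>f x\<bar> \<partial>lebesgue)"
    if "(c, r) \<in> K" for c r
    using that V unfolding p_def K_def
    by (intro young_emeasure_le_of_less_average[OF \<Phi> \<Psi> \<open>0 < C\<close> \<open>0 \<le> \<theta>\<close> inv f _ le1 _ _ \<open>0 < t\<close>,
          where v = "measure lebesgue (ball c r)"])
       (auto simp: emeasure_ball content_ball V_def)
  have "p * emeasure lebesgue (\<Union>x\<in>K. ball (fst x) (snd x)) \<le> ennreal (5 ^ CARD('n))"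
  proof (cases "p = 0")
    case False
    \<comment> \<open>As \<open>p\<close> may be infinite, a finite positive \<open>q\<close> below
      it takes over in the bound on the radii.\<close>
    obtain q where q: "0 < q" "ennreal q \<le> p"
    proof (cases p)
      case (real x)
      then show ?thesis using False that[of x] by (auto simp: less_le)
    qed (use that[of 1] in auto)
    \<comment> \<open>Vitali needs bounded radii. Each ball in \<open>K\<close> has volume at most
      \<open>1 / q\<close>, and \<open>r \<le> r ^ n\<close> for \<open>1 < r\<close> avoids taking
      a root.\<close>
    have rad: "0 < r \<and> r \<le> max 1 (1 / (q * V))" if K: "(c, r) \<in> K" for c r
    proof
      show "0 < r" using K by (auto simp: K_def)
      have "ennreal q * ennreal (V * r ^ CARD('n)) \<le> p * emeasure lebesgue (ball c r)"
        using \<open>0 < r\<close> q by (auto simp: emeasure_ball V_def intro!: mult_right_mono)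
      also have "\<dots> \<le> 1" using ball_le[OF K] le1 order_trans by blast
      finally have "q * (V * r ^ CARD('n)) \<le> 1"
        using q V \<open>0 < r\<close> by (simp flip: ennreal_mult)
      then have "r ^ CARD('n) \<le> 1 / (q * V)"
        using q V by (simp add: field_simps)
      moreover have "r \<le> r ^ CARD('n)" if "1 < r"
        using that by (intro self_le_power) auto
      ultimately show "r \<le> max 1 (1 / (q * V))" by linarith
    qed
    have "emeasure (scale_measure p lebesgue) (\<Union>x\<in>K. ball (fst x) (snd x))
        \<le> ennreal (5 ^ CARD('n)) * emeasure (density lebesgue (\<lambda>x. \<Phi> \<bar>f x\<bar>)) (\<Union>x\<in>K. ball (fst x) (snd x))"
    proof (rule Vitali_emeasure_le[where R = "max 1 (1 / (q * V))"])
      fix x assume "x \<in> K"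
      then obtain c r where x: "x = (c, r)" "(c, r) \<in> K" by (cases x) auto
      show "0 < snd x \<and> snd x \<le> max 1 (1 / (q * V))" using x rad by auto
      have r: "0 < r" using x rad by auto
      have "p * emeasure lebesgue (ball c (5 * r)) = p * (ennreal (5 ^ CARD('n)) * emeasure lebesgue (ball c r))"
        using r by (simp add: emeasure_ball power_mult_distrib mult_ac flip: ennreal_mult)
      also have "\<dots> \<le> ennreal (5 ^ CARD('n)) * (\<integral>\<^sup>+x\<in>ball c r. \<Phi> \<bar>f x\<bar> \<partial>lebesgue)"
        using ball_le[OF x(2)] by (subst mult.left_commute) (rule mult_left_mono, auto)
      finally show "emeasure (scale_measure p lebesgue) (ball (fst x) (5 * snd x))
        \<le> ennreal (5 ^ CARD('n)) * emeasure (density lebesgue (\<lambda>x. \<Phi> \<bar>f x\<bar>)) (ball (fst x) (snd x))"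
        by (simp add: x emeasure_density)
    qed auto
    also have "emeasure (density lebesgue (\<lambda>x. \<Phi> \<bar>f x\<bar>)) (\<Union>x\<in>K. ball (fst x) (snd x)) \<le> 1"
      using le1 by (subst emeasure_density) (auto intro!: sets_completionI_sets borel_open open_UN)
    finally show ?thesis by (simp add: mult_left_mono)
  qed simp
  then show ?thesis by (simp add: p_def K_def case_prod_beta)
qed

section \<open>The commutator with a Lipschitz symbol\<close>

text \<open>Two points of a ball of radius \<open>r\<close> are at distance at most
  \<open>2 * r\<close>, and \<open>r powr \<beta>\<close> is a multiple of the volume to the power
  \<open>\<beta> / n\<close>; \<open>D\<close> collects the constants. So the oscillation of the
  symbol raises the exponent from \<open>\<alpha> / n\<close> to
  \<open>(\<alpha> + \<beta>) / n\<close>. Since \<open>b\<close> is Lipschitz only up to a null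
  set, bad points \<open>x\<close> go into the exceptional set, while bad \<open>y\<close> vanish in
  the integral.\<close>

lemma frac_max_commutator_weak_set_subset:
  fixes b b' f :: "real ^ 'n \<Rightarrow> real"
  assumes f [measurable]: "f \<in> borel_measurable lebesgue"
    and ae: "AE x in lebesgue. b x = b' x"
    and L: "0 \<le> L" "\<And>x y. \<bar>b' x - b' y\<bar> \<le> L * norm (x - y) powr \<beta>" and "0 < \<beta>"
    and l: "0 < l"
    and D: "D = L * (2 powr \<beta> * unit_ball_vol (real CARD('n)) powr (- (\<beta> / real CARD('n))))"
    and "D * l \<le> k" "0 < k"
  shows "{x. ennreal t < frac_max_commutator b \<alpha> f x / ennreal k} \<subseteq>
    (\<Union>(c, r)\<in>{(c, r). 0 < r \<and> ennreal t <
      ennreal (measure lebesgue (ball c r) powr (- 1 + (\<alpha> + \<beta>) / real CARD('n))) *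
      (\<integral>\<^sup>+x\<in>ball c r. ennreal \<bar>f x / l\<bar> \<partial>lebesgue)}. ball c r) \<union> {x. b x \<noteq> b' x}"
proof
  fix x assume x: "x \<in> {x. ennreal t < frac_max_commutator b \<alpha> f x / ennreal k}"
  define V where "V = unit_ball_vol (real CARD('n))"
  have V: "0 < V" by (simp add: V_def)
  show "x \<in> (\<Union>(c, r)\<in>{(c, r). 0 < r \<and> ennreal t <
      ennreal (measure lebesgue (ball c r) powr (- 1 + (\<alpha> + \<beta>) / real CARD('n))) *
      (\<integral>\<^sup>+x\<in>ball c r. ennreal \<bar>f x / l\<bar> \<partial>lebesgue)}. ball c r) \<union> {x. b x \<noteq> b' x}"
  proof (cases "b x = b' x")
    case True
    have "ennreal t < frac_max_commutator b \<alpha> f x * inverse (ennreal k)"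
      using x by (simp add: divide_ennreal_def)
    also have "\<dots> = (SUP B\<in>{ball c r | c r. x \<in> ball c r}.
        ennreal (measure lebesgue B powr (- 1 + \<alpha> / real CARD('n))) *
        (\<integral>\<^sup>+ y\<in>B. ennreal (\<bar>b x - b y\<bar> * \<bar>f y\<bar>) \<partial>lebesgue) * inverse (ennreal k))"
      unfolding frac_max_commutator_def by (rule SUP_mult_right_ennreal)
    finally obtain c r where cr: "x \<in> ball c r"
      and less: "ennreal t < ennreal (measure lebesgue (ball c r) powr (- 1 + \<alpha> / real CARD('n))) *
        (\<integral>\<^sup>+ y\<in>ball c r. ennreal (\<bar>b x - b y\<bar> * \<bar>f y\<bar>) \<partial>lebesgue) * inverse (ennreal k)"
      unfolding less_SUP_iff by auto
    have [measurable]: "ball c r \<in> sets lebesgue" by simp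
    have r: "0 < r" using cr zero_le_dist[of c x] unfolding mem_ball by linarith
    define v where "v = measure lebesgue (ball c r)"
    have v: "v = V * r ^ CARD('n)" "0 < v"
      using r V by (simp_all add: v_def content_ball V_def)
    have rv: "L * (2 * r) powr \<beta> = D * v powr (\<beta> / real CARD('n))"
    proof -
      have "v powr (\<beta> / real CARD('n)) = V powr (\<beta> / real CARD('n)) * r powr \<beta>"
        using V r by (simp add: v powr_mult powr_realpow[symmetric] powr_powr)
      then show ?thesis
        using V r by (simp add: D V_def[symmetric] powr_mult powr_minus field_simps)
    qed
    have pt: "ennreal (\<bar>b x - b y\<bar> * \<bar>f y\<bar>) \<le> ennreal (D * v powr (\<beta> / real CARD('n)) * l) * ennreal \<bar>f y / l\<bar>"
      if "y \<in> ball c r" "b y = b' y" for y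
    proof -
      have "norm (x - y) \<le> 2 * r"
        using cr that(1) dist_triangle2[of x y c] by (simp add: dist_norm norm_minus_commute)
      then have "norm (x - y) powr \<beta> \<le> (2 * r) powr \<beta>"
        using \<open>0 < \<beta>\<close> by (intro powr_mono2) auto
      then have "\<bar>b x - b y\<bar> \<le> L * (2 * r) powr \<beta>"
        using L(2)[of x y] mult_left_mono[OF _ L(1)] True that(2) by fastforce
      then have "\<bar>b x - b y\<bar> * \<bar>f y\<bar> \<le> D * v powr (\<beta> / real CARD('n)) * \<bar>f y\<bar>"
        unfolding rv by (intro mult_right_mono) auto
      also have "\<dots> = D * v powr (\<beta> / real CARD('n)) * l * \<bar>f y / l\<bar>"
        using l by simp
      finally show ?thesis
        using L l by (subst ennreal_mult[symmetric]) (auto intro!: ennreal_leI simp: D)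
    qed
    have "(\<integral>\<^sup>+ y\<in>ball c r. ennreal (\<bar>b x - b y\<bar> * \<bar>f y\<bar>) \<partial>lebesgue)
        \<le> (\<integral>\<^sup>+ y. ennreal (D * v powr (\<beta> / real CARD('n)) * l) * (ennreal \<bar>f y / l\<bar> * indicator (ball c r) y) \<partial>lebesgue)"
      using ae by (intro nn_integral_mono_AE, eventually_elim) (use pt in \<open>auto simp: indicator_def\<close>)
    also have "\<dots> = ennreal (D * v powr (\<beta> / real CARD('n)) * l) * (\<integral>\<^sup>+ y\<in>ball c r. ennreal \<bar>f y / l\<bar> \<partial>lebesgue)"
      by (rule nn_integral_cmult) measurable
    finally have "ennreal t < ennreal (v powr (- 1 + \<alpha> / real CARD('n))) *
        (ennreal (D * v powr (\<beta> / real CARD('n)) * l) * (\<integral>\<^sup>+ y\<in>ball c r. ennreal \<bar>f y / l\<bar> \<partial>lebesgue))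
        * inverse (ennreal k)"
      using less unfolding v_def
      by (elim less_le_trans) (intro mult_left_mono mult_right_mono, auto)
    also have "\<dots> = (ennreal (v powr (- 1 + \<alpha> / real CARD('n))) *
        ennreal (D * v powr (\<beta> / real CARD('n)) * l) * ennreal (1 / k)) * (\<integral>\<^sup>+ y\<in>ball c r. ennreal \<bar>f y / l\<bar> \<partial>lebesgue)"
      using \<open>0 < k\<close> by (simp add: inverse_ennreal mult_ac inverse_eq_divide)
    also have "ennreal (v powr (- 1 + \<alpha> / real CARD('n))) * ennreal (D * v powr (\<beta> / real CARD('n)) * l) * ennreal (1 / k)
       = ennreal (v powr (- 1 + \<alpha> / real CARD('n)) * (D * v powr (\<beta> / real CARD('n)) * l) * (1 / k))"
      using L l \<open>0 < k\<close> by (simp add: D flip: ennreal_mult)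
    also have "v powr (- 1 + \<alpha> / real CARD('n)) * (D * v powr (\<beta> / real CARD('n)) * l) * (1 / k)
        = v powr (- 1 + (\<alpha> + \<beta>) / real CARD('n)) * (D * l / k)"
      by (simp add: powr_add[symmetric] add_divide_distrib[symmetric] mult_ac add_ac)
         (simp add: powr_add[symmetric] diff_divide_distrib add_divide_distrib algebra_simps)
    also have "ennreal \<dots> * (\<integral>\<^sup>+ y\<in>ball c r. ennreal \<bar>f y / l\<bar> \<partial>lebesgue)
        \<le> ennreal (v powr (- 1 + (\<alpha> + \<beta>) / real CARD('n))) * (\<integral>\<^sup>+ y\<in>ball c r. ennreal \<bar>f y / l\<bar> \<partial>lebesgue)"
      using \<open>D * l \<le> k\<close> \<open>0 < k\<close>
      by (intro mult_right_mono ennreal_leI mult_left_le) (auto simp: field_simps)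
    finally show ?thesis using cr r unfolding v_def by blast
  qed auto
qed

lemma lipschitz_imp_bounded_orlicz_to_weak:
  fixes b :: "real ^ 'n \<Rightarrow> real"
  assumes \<Phi>: "\<Phi> \<in> young_class_Y" and \<Psi>: "young_function \<Psi>"
    and "0 < \<beta>" "0 \<le> \<alpha> + \<beta>" "0 < C"
    and inv: "\<And>t. 0 < t \<Longrightarrow> t powr (- ((\<alpha> + \<beta>) / real CARD('n))) * young_inverse \<Phi> t \<le> C * young_inverse \<Psi> t"
    and b: "b \<in> lipschitz_space \<beta>"
  shows "bounded_orlicz_to_weak \<Phi> \<Psi> (frac_max_commutator b \<alpha>)"
proof -
  obtain b' L0 where ae: "AE x in lebesgue. b x = b' x"
    and L0: "\<And>x y. \<bar>b' x - b' y\<bar> \<le> L0 * norm (x - y) powr \<beta>"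
    using b by (auto simp: lipschitz_space_def)
  \<comment> \<open>The maximum with 1 makes the constant positive, so that \<open>D\<close> and
    \<open>Q\<close> can be divided by.\<close>
  define L where "L = max 1 L0"
  have L: "0 < L" "\<And>x y. \<bar>b' x - b' y\<bar> \<le> L * norm (x - y) powr \<beta>"
    by (simp add: L_def) (rule order_trans[OF L0], simp add: L_def mult_right_mono)
  define D where "D = L * (2 powr \<beta> * unit_ball_vol (real CARD('n)) powr (- (\<beta> / real CARD('n))))"
  define N where "N = (5::real) ^ CARD('n)"
  \<comment> \<open>\<open>D\<close> comes from the pointwise bound, \<open>4 * C\<close> from the
    level in the weak type bound, and \<open>N\<close> is there to absorb the Vitali
    constant.\<close>
  define Q where "Q = D * (4 * C * N)"
  have D: "0 < D" using L(1) unfolding D_def by (intro mult_pos_pos) (simp_all add: less_imp_neq[symmetric])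
  have N: "1 \<le> N" by (simp add: N_def)
  have Q: "0 < Q" using D N \<open>0 < C\<close> by (simp add: Q_def)
  have null: "{x. b x \<noteq> b' x} \<in> null_sets lebesgue"
    using ae by (auto simp: eventually_ae_filter intro: null_sets_completion_subset)
  have main: "weak_orlicz_norm \<Psi> (frac_max_commutator b \<alpha> f) \<le> ennreal Q * ennreal l"
    if f: "f \<in> orlicz_space \<Phi>" and l: "0 < l" and one: "(\<integral>\<^sup>+ x. \<Phi> (\<bar>f x\<bar> / l) \<partial>lebesgue) \<le> 1" for f l
  proof -
    have fm [measurable]: "f \<in> borel_measurable lebesgue"
      using f by (intro L1_loc_borel_measurable) (simp add: orlicz_space_def)
    have "\<Psi> t * emeasure lebesgue {x. ennreal t < frac_max_commutator b \<alpha> f x / ennreal (Q * l)} \<le> 1"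
      if "0 < t" for t
    proof -
      \<comment> \<open>Level \<open>t\<close> after division by \<open>Q * l\<close> is level
        \<open>s\<close> after division by \<open>D * l\<close>, and \<open>s / (4 * C)\<close>
        equals \<open>N * t\<close>.\<close>
      define s where "s = 4 * C * N * t"
      define E where "E = (\<Union>(c, r)\<in>{(c, r). 0 < r \<and> ennreal s <
        ennreal (measure lebesgue (ball c r) powr (- 1 + (\<alpha> + \<beta>) / real CARD('n))) *
        (\<integral>\<^sup>+x\<in>ball c r. ennreal \<bar>f x / l\<bar> \<partial>lebesgue)}. ball c r)"
      have Em: "E \<in> sets lebesgue"
        unfolding E_def by (intro sets_completionI_sets) (auto intro!: borel_open open_UN)
      have "s > 0" using \<open>0 < C\<close> N \<open>0 < t\<close> by (simp add: s_def)
      have "ennreal t < frac_max_commutator b \<alpha> f x / ennreal (Q * l) \<longleftrightarrow>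
          ennreal s < frac_max_commutator b \<alpha> f x / ennreal (D * l)" for x
      proof -
        have "ennreal t < z / ennreal (Q * l) \<longleftrightarrow> ennreal s < z / ennreal (D * l)" for z
        proof (cases z)
          case (real z)
          then show ?thesis
            using D Q l \<open>0 < C\<close> N \<open>0 < t\<close> \<open>0 < s\<close>
            by (simp add: divide_ennreal ennreal_less_iff) (simp add: s_def Q_def field_simps)
        next
          case top
          then show ?thesis using D Q l by (simp add: ennreal_top_divide)
        qed
        then show ?thesis .
      qed
      then have "{x. ennreal t < frac_max_commutator b \<alpha> f x / ennreal (Q * l)} \<subseteq> E \<union> {x. b x \<noteq> b' x}"
        using frac_max_commutator_weak_set_subset[OF fm ae less_imp_le[OF L(1)] L(2) \<open>0 < \<beta>\<close> l D_def order_refl,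
            of s \<alpha>] D l unfolding E_def by auto
      then have "emeasure lebesgue {x. ennreal t < frac_max_commutator b \<alpha> f x / ennreal (Q * l)}
          \<le> emeasure lebesgue (E \<union> {x. b x \<noteq> b' x})"
        using Em null by (intro emeasure_mono) auto
      also have "\<dots> = emeasure lebesgue E"
        using Em null by (rule emeasure_Un_null_set)
      finally have 1: "emeasure lebesgue {x. ennreal t < frac_max_commutator b \<alpha> f x / ennreal (Q * l)}
          \<le> emeasure lebesgue E" .
      \<comment> \<open>The weak norm asks for the bound 1, not \<open>N\<close>. Convexity supplies
        the factor \<open>1 / N\<close> when the level is raised from \<open>t\<close> to
        \<open>N * t\<close>.\<close>
      have "\<Psi> (1 / N * (N * t)) \<le> ennreal (1 / N) * \<Psi> (N * t)"
        using N \<open>0 < t\<close> by (intro young_function_scale_le[OF \<Psi>]) auto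
      then have 2: "\<Psi> t \<le> ennreal (1 / N) * \<Psi> (N * t)" using N by simp
      have "\<Psi> (s / (4 * C)) * emeasure lebesgue E \<le> ennreal N"
        unfolding E_def N_def
      proof (rule fractional_maximal_weak_bound[OF \<Phi> \<Psi> \<open>0 < C\<close> _ inv _ _ \<open>0 < s\<close>])
        show "0 \<le> (\<alpha> + \<beta>) / real CARD('n)" using \<open>0 \<le> \<alpha> + \<beta>\<close> by simp
        show "(\<integral>\<^sup>+ x. \<Phi> \<bar>f x / l\<bar> \<partial>lebesgue) \<le> 1" using one l by (simp add: abs_divide)
      qed auto
      then have 3: "\<Psi> (N * t) * emeasure lebesgue E \<le> ennreal N"
        using \<open>0 < C\<close> by (simp add: s_def)
      have "\<Psi> t * emeasure lebesgue {x. ennreal t < frac_max_commutator b \<alpha> f x / ennreal (Q * l)}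
          \<le> ennreal (1 / N) * \<Psi> (N * t) * emeasure lebesgue E"
        using 2 1 by (rule mult_mono) auto
      also have "\<dots> \<le> ennreal (1 / N) * ennreal N"
        unfolding mult.assoc using 3 by (rule mult_left_mono) simp
      also have "\<dots> = 1" using N by (simp flip: ennreal_mult)
      finally show ?thesis .
    qed
    then have "(SUP t\<in>{0<..}. \<Psi> t * emeasure lebesgue {x. ennreal t < frac_max_commutator b \<alpha> f x / ennreal (Q * l)}) \<le> 1"
      by (intro SUP_least) auto
    then have "weak_orlicz_norm \<Psi> (frac_max_commutator b \<alpha> f) \<le> ennreal (Q * l)"
      unfolding weak_orlicz_norm_def using Q l by (intro Inf_lower imageI) auto
    then show ?thesis using Q l by (simp add: ennreal_mult)
  qed
  have "weak_orlicz_norm \<Psi> (frac_max_commutator b \<alpha> f) \<le> ennreal Q * orlicz_norm \<Phi> f"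
    if f: "f \<in> orlicz_space \<Phi>" for f
  proof -
    \<comment> \<open>After division by \<open>Q\<close> the estimate \<open>main\<close> is a lower
      bound for each competitor in the infimum, including the case of no competitor.\<close>
    have "weak_orlicz_norm \<Psi> (frac_max_commutator b \<alpha> f) / ennreal Q \<le> orlicz_norm \<Phi> f"
      unfolding orlicz_norm_def
      using main[OF f] Q
      by (intro Inf_greatest) (auto simp: divide_le_posI_ennreal mult.commute)
    then have "ennreal Q * (weak_orlicz_norm \<Psi> (frac_max_commutator b \<alpha> f) / ennreal Q) \<le> ennreal Q * orlicz_norm \<Phi> f"
      by (rule mult_left_mono) simp
    then show ?thesis
      using Q mult_divide_eq_ennreal[of "ennreal Q" "weak_orlicz_norm \<Psi> (frac_max_commutator b \<alpha> f)"]
      by (simp add: ennreal_times_divide mult.commute[of "ennreal Q" "weak_orlicz_norm _ _"])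
  qed
  then show ?thesis unfolding bounded_orlicz_to_weak_def by blast
qed

section \<open>Necessity\<close>

text \<open>Vitali at the single scale \<open>d\<close>, for the measure with density
  \<open>\<bar>b y - b' y\<bar>\<close>, bounds the mass of a fixed ball by a multiple of
  \<open>d powr \<beta>\<close>, and \<open>d\<close> tends to 0. This takes the place of a
  differentiation theorem.\<close>

lemma AE_eq_of_set_nn_integral_ball_le:
  fixes b b' :: "real ^ 'n \<Rightarrow> real"
  assumes [measurable]: "b \<in> borel_measurable lebesgue" "b' \<in> borel_measurable lebesgue"
    and "0 < \<beta>" "0 < A"
    and diff': "\<And>c r. 0 < r \<Longrightarrow> (\<integral>\<^sup>+y\<in>ball c r. ennreal \<bar>b y - b' y\<bar> \<partial>lebesgue)
                \<le> ennreal (A * r powr \<beta> * measure lebesgue (ball c r))"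
  shows "AE x in lebesgue. b x = b' x"
proof -
  define V where "V = unit_ball_vol (real CARD('n))"
  have V: "0 < V" by (simp add: V_def)
  have meas: "measure lebesgue (ball c r) = V * r ^ CARD('n)" "emeasure lebesgue (ball c r) = ennreal (V * r ^ CARD('n))"
    if "0 < r" for c :: "real ^ 'n" and r
    using that by (simp_all add: content_ball emeasure_ball V_def)
  have diff: "(\<integral>\<^sup>+y\<in>ball c r. ennreal \<bar>b y - b' y\<bar> \<partial>lebesgue) \<le> ennreal (A * r powr \<beta> * (V * r ^ CARD('n)))"
    if "0 < r" for c r
    using diff'[OF that, of c] unfolding meas[OF that] .
  define \<mu> where "\<mu> = density lebesgue (\<lambda>y. ennreal \<bar>b y - b' y\<bar>)"
  have \<mu>: "emeasure \<mu> S = (\<integral>\<^sup>+y\<in>S. ennreal \<bar>b y - b' y\<bar> \<partial>lebesgue)" if "S \<in> sets lebesgue" for S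
    using that by (simp add: \<mu>_def emeasure_density)
  have null: "emeasure \<mu> (ball 0 R) = 0" if R: "0 < R" for R
  proof -
    \<comment> \<open>The powers of 5 come from using the hypothesis on the dilated radius
      \<open>5 * d\<close>.\<close>
    define P where "P = A * 5 powr \<beta> * 5 ^ CARD('n)"
    have P: "0 < P" using \<open>0 < A\<close> by (simp add: P_def)
    have bound: "emeasure \<mu> (ball 0 R) \<le> ennreal (P * d powr \<beta> * (V * (R + 1) ^ CARD('n)))"
      if d: "0 < d" "d \<le> 1" for d
    proof -
      have sub: "ball 0 R \<subseteq> (\<Union>i\<in>ball 0 R. ball i d)" using d by auto
      have sub': "(\<Union>i\<in>ball 0 R. ball i d) \<subseteq> ball (0 :: real ^ 'n) (R + 1)"
        using d by (intro UN_least) (auto simp: ball_subset_ball_iff)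
      have op: "(\<Union>i\<in>ball (0 :: real ^ 'n) R. ball i d) \<in> sets lebesgue"
        by (auto intro!: sets_completionI_sets borel_open open_UN)
      have "emeasure \<mu> (ball 0 R) \<le> emeasure \<mu> (\<Union>i\<in>ball 0 R. ball i d)"
        using sub op by (intro emeasure_mono) (auto simp: \<mu>_def)
      also have "\<dots> \<le> ennreal (P * d powr \<beta>) * emeasure lebesgue (\<Union>i\<in>ball (0 :: real ^ 'n) R. ball i d)"
      proof (rule Vitali_emeasure_le[where R = 1])
        fix i :: "real ^ 'n"
        have "emeasure \<mu> (ball i (5 * d)) \<le> ennreal (A * (5 * d) powr \<beta> * (V * (5 * d) ^ CARD('n)))"
          using diff[of "5 * d" i] d by (simp add: \<mu>)
        also have "\<dots> = ennreal (P * d powr \<beta>) * emeasure lebesgue (ball i d)"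
          using d P V \<open>0 < A\<close>
          by (simp add: meas P_def powr_mult power_mult_distrib mult_ac flip: ennreal_mult del: emeasure_completion)
        finally show "emeasure \<mu> (ball i (5 * d)) \<le> ennreal (P * d powr \<beta>) * emeasure lebesgue (ball i d)" .
      qed (use d in \<open>auto simp: \<mu>_def\<close>)
      \<comment> \<open>Because \<open>d \<le> 1\<close>, all covering balls stay in one ball that
        does not depend on \<open>d\<close>.\<close>
      also have "\<dots> \<le> ennreal (P * d powr \<beta>) * emeasure lebesgue (ball (0 :: real ^ 'n) (R + 1))"
        using sub' by (intro mult_left_mono emeasure_mono) auto
      also have "\<dots> = ennreal (P * d powr \<beta> * (V * (R + 1) ^ CARD('n)))"
        using P V R by (subst meas) (auto simp flip: ennreal_mult)
      finally show ?thesis .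
    qed
    have "((\<lambda>k. ennreal (P * (1 / real (Suc k)) powr \<beta> * (V * (R + 1) ^ CARD('n)))) \<longlongrightarrow> ennreal (P * 0 powr \<beta> * (V * (R + 1) ^ CARD('n)))) sequentially"
      using \<open>0 < \<beta>\<close> LIMSEQ_inverse_real_of_nat
      by (intro tendsto_intros tendsto_powr') (auto simp: inverse_eq_divide)
    then have "emeasure \<mu> (ball 0 R) \<le> ennreal (P * 0 powr \<beta> * (V * (R + 1) ^ CARD('n)))"
      by (rule tendsto_lowerbound) (auto intro!: always_eventually bound)
    then show ?thesis by simp
  qed
  have "emeasure \<mu> (\<Union>k. ball 0 (real (Suc k))) = 0"
    using null by (intro emeasure_UN_eq_0) (auto simp: \<mu>_def)
  moreover have "(\<Union>k. ball (0 :: real ^ 'n) (real (Suc k))) = UNIV"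
  proof -
    have "\<exists>k. norm x < real (Suc k)" for x :: "real ^ 'n"
      using reals_Archimedean2[of "norm x"] by (metis less_trans lessI of_nat_less_iff)
    then show ?thesis by auto
  qed
  ultimately have "(\<integral>\<^sup>+y. ennreal \<bar>b y - b' y\<bar> \<partial>lebesgue) = 0"
    using \<mu>[of UNIV] by simp
  then have "AE y in lebesgue. ennreal \<bar>b y - b' y\<bar> = 0"
    by (subst (asm) nn_integral_0_iff_AE) auto
  then show ?thesis by eventually_elim auto
qed

lemma lipschitz_space_of_mean_oscillation:
  fixes b :: "real ^ 'n \<Rightarrow> real"
  assumes b [measurable]: "b \<in> borel_measurable lebesgue" and "0 < \<beta>" "0 < A"
    and osc: "\<And>c r. 0 < r \<Longrightarrow> \<exists>z. (\<integral>\<^sup>+y\<in>ball c r. ennreal \<bar>b y - z\<bar> \<partial>lebesgue)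
                \<le> ennreal (A * r powr \<beta> * measure lebesgue (ball c r))"
  shows "b \<in> lipschitz_space \<beta>"
proof -
  define V where "V = unit_ball_vol (real CARD('n))"
  have V: "0 < V" by (simp add: V_def)
  have meas: "measure lebesgue (ball c r) = V * r ^ CARD('n)" "emeasure lebesgue (ball c r) = ennreal (V * r ^ CARD('n))"
    if "0 < r" for c :: "real ^ 'n" and r
    using that by (simp_all add: content_ball emeasure_ball V_def)
  \<comment> \<open>Arbitrary constants with small oscillation replace the averages, so integrability is never needed.\<close>
  define z where "z c r = (SOME z. (\<integral>\<^sup>+y\<in>ball c r. ennreal \<bar>b y - z\<bar> \<partial>lebesgue)
                \<le> ennreal (A * r powr \<beta> * measure lebesgue (ball c r)))" for c r
  have z: "(\<integral>\<^sup>+y\<in>ball c r. ennreal \<bar>b y - z c r\<bar> \<partial>lebesgue)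
                \<le> ennreal (A * r powr \<beta> * (V * r ^ CARD('n)))" if "0 < r" for c r
    using someI_ex[OF osc[OF that, of c]] unfolding z_def meas[OF that] .
  have [measurable]: "ball c r \<in> sets lebesgue" for c :: "real ^ 'n" and r by simp
  \<comment> \<open>In \<open>close\<close> the constant \<open>\<bar>z c' r' - z c r\<bar>\<close>
    is integrated over the smaller ball. That ball contributes \<open>A\<close>; the larger one, of
    at most \<open>2 ^ n\<close> times the volume, contributes the rest.\<close>
  define D where "D = A * (1 + 2 ^ CARD('n))"
  have D: "0 < D" using \<open>0 < A\<close> by (simp add: D_def add_pos_pos)
  have close: "\<bar>z c' r' - z c r\<bar> \<le> D * r powr \<beta>"
    if "0 < r'" "r' \<le> r" "r \<le> 2 * r'" "ball c' r' \<subseteq> ball c r" for c c' r r'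
  proof -
    let ?v = "V * r' ^ CARD('n)"
    have "ennreal (\<bar>z c' r' - z c r\<bar> * ?v) = (\<integral>\<^sup>+y\<in>ball c' r'. ennreal \<bar>z c' r' - z c r\<bar> \<partial>lebesgue)"
      using that V by (simp add: nn_integral_cmult_indicator meas ennreal_mult emeasure_ball V_def)
    also have "\<dots> \<le> (\<integral>\<^sup>+y. ennreal \<bar>b y - z c' r'\<bar> * indicator (ball c' r') y + ennreal \<bar>b y - z c r\<bar> * indicator (ball c r) y \<partial>lebesgue)"
      using that(4) by (intro nn_integral_mono) (auto simp: indicator_def simp flip: ennreal_plus intro!: ennreal_leI)
    also have "\<dots> = (\<integral>\<^sup>+y\<in>ball c' r'. ennreal \<bar>b y - z c' r'\<bar> \<partial>lebesgue) + (\<integral>\<^sup>+y\<in>ball c r. ennreal \<bar>b y - z c r\<bar> \<partial>lebesgue)"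
      by (rule nn_integral_add) measurable
    also have "\<dots> \<le> ennreal (A * r' powr \<beta> * ?v) + ennreal (A * r powr \<beta> * (V * r ^ CARD('n)))"
      using that by (intro add_mono z) auto
    also have "\<dots> = ennreal (A * r' powr \<beta> * ?v + A * r powr \<beta> * (V * r ^ CARD('n)))"
      using that V \<open>0 < A\<close> by (simp flip: ennreal_plus)
    finally have "\<bar>z c' r' - z c r\<bar> * ?v \<le> A * r' powr \<beta> * ?v + A * r powr \<beta> * (V * r ^ CARD('n))"
      using that V \<open>0 < A\<close> by (subst (asm) ennreal_le_iff) auto
    also have "\<dots> \<le> A * r powr \<beta> * ?v + A * r powr \<beta> * (V * (2 * r') ^ CARD('n))"
      using that V \<open>0 < A\<close> \<open>0 < \<beta>\<close>
      by (intro add_mono mult_mono mult_left_mono powr_mono2 power_mono) auto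
    also have "\<dots> = D * r powr \<beta> * ?v"
      by (simp add: D_def power_mult_distrib algebra_simps)
    finally show ?thesis using that V by simp
  qed
  \<comment> \<open>\<open>H\<close> is the sum of the geometric series with first term
    \<open>D\<close> and ratio \<open>2 powr (- \<beta>)\<close>. The identity
    \<open>H * 2 powr (- \<beta>) + D = H\<close> lets the induction over halvings of the radius
    reproduce its constant.\<close>
  define H where "H = D / (1 - 2 powr (- \<beta>))"
  have q: "2 powr (- \<beta>) < (1::real)"
    using powr_less_mono[of "- \<beta>" 0 "2::real"] \<open>0 < \<beta>\<close> by simp
  have "0 < H" "H * (1 - 2 powr (- \<beta>)) = D"
    using q D \<open>0 < \<beta>\<close> by (simp_all add: H_def)
  then have H: "0 < H" "H * 2 powr (- \<beta>) + D = H"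
    by (simp_all add: algebra_simps)
  have "0 \<le> H * 2 powr (- \<beta>)" using H by simp
  then have "D \<le> H" using H(2) by linarith
  have iter: "\<bar>z c s - z c r\<bar> \<le> H * r powr \<beta>" if "0 < s" "s \<le> r" "r \<le> 2 ^ k * s" for c s r k
    using that
  proof (induction k arbitrary: r)
    case 0
    then show ?case using H by simp
  next
    case (Suc k)
    show ?case
    proof (cases "r \<le> 2 * s")
      case True
      then have "\<bar>z c s - z c r\<bar> \<le> D * r powr \<beta>"
        using Suc.prems by (intro close) auto
      also have "\<dots> \<le> H * r powr \<beta>" using \<open>D \<le> H\<close> by (intro mult_right_mono) auto
      finally show ?thesis .
    next
      case False
      have "\<bar>z c s - z c (r / 2)\<bar> \<le> H * (r / 2) powr \<beta>"
        using Suc.prems False by (intro Suc.IH) auto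
      moreover have "\<bar>z c (r / 2) - z c r\<bar> \<le> D * r powr \<beta>"
        using Suc.prems by (intro close) auto
      moreover have "(r / 2) powr \<beta> = 2 powr (- \<beta>) * r powr \<beta>"
        using Suc.prems by (simp add: powr_divide powr_minus field_simps)
      ultimately have "\<bar>z c s - z c r\<bar> \<le> (H * 2 powr (- \<beta>) + D) * r powr \<beta>"
        by (simp add: algebra_simps)
      then show ?thesis by (simp add: H)
    qed
  qed
  have zH: "\<bar>z c s - z c r\<bar> \<le> H * r powr \<beta>" if "0 < s" "s \<le> r" for c s r
  proof -
    obtain k where "r / s < 2 ^ k" using real_arch_pow[of 2 "r / s"] by auto
    then show ?thesis using that by (intro iter[of s r k]) (auto simp: field_simps)
  qed
  have small: "((\<lambda>k. H * (1 / real (Suc k)) powr \<beta>) \<longlongrightarrow> 0) sequentially"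
  proof -
    have "((\<lambda>k. H * (1 / real (Suc k)) powr \<beta>) \<longlongrightarrow> H * 0 powr \<beta>) sequentially"
      using \<open>0 < \<beta>\<close> LIMSEQ_inverse_real_of_nat
      by (intro tendsto_intros tendsto_powr') (auto simp: inverse_eq_divide)
    then show ?thesis by simp
  qed
  define b' where "b' c = lim (\<lambda>k. z c (1 / real (Suc k)))" for c
  have conv: "(\<lambda>k. z c (1 / real (Suc k))) \<longlonglongrightarrow> b' c" for c
  proof -
    have "Cauchy (\<lambda>k. z c (1 / real (Suc k)))"
    proof (rule CauchyI')
      fix e :: real assume "0 < e"
      then have "eventually (\<lambda>k. H * (1 / real (Suc k)) powr \<beta> < e) sequentially"
        using order_tendstoD(2)[OF small] by blast
      then obtain M where M: "\<And>k. k \<ge> M \<Longrightarrow> H * (1 / real (Suc k)) powr \<beta> < e"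
        by (auto simp: eventually_sequentially)
      show "\<exists>M. \<forall>m\<ge>M. \<forall>n>m. dist (z c (1 / real (Suc m))) (z c (1 / real (Suc n))) < e"
      proof (intro exI[of _ M] allI impI)
        fix m n assume "M \<le> m" "m < n"
        have "\<bar>z c (1 / real (Suc n)) - z c (1 / real (Suc m))\<bar> \<le> H * (1 / real (Suc m)) powr \<beta>"
          using \<open>m < n\<close> by (intro zH) (auto simp: field_simps)
        also have "\<dots> < e" using M \<open>M \<le> m\<close> by blast
        finally show "dist (z c (1 / real (Suc m))) (z c (1 / real (Suc n))) < e"
          by (simp add: dist_real_def abs_minus_commute)
      qed
    qed
    then show ?thesis unfolding b'_def by (simp add: Cauchy_convergent convergent_LIMSEQ_iff[symmetric])
  qed
  have b'z: "\<bar>b' c - z c r\<bar> \<le> H * r powr \<beta>" if "0 < r" for c r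
  proof (rule tendsto_upperbound)
    show "(\<lambda>k. \<bar>z c (1 / real (Suc k)) - z c r\<bar>) \<longlonglongrightarrow> \<bar>b' c - z c r\<bar>"
      by (intro tendsto_intros conv)
    have "eventually (\<lambda>k. 1 / real (Suc k) < r) sequentially"
      using order_tendstoD(2)[OF LIMSEQ_inverse_real_of_nat \<open>0 < r\<close>] by (simp add: inverse_eq_divide)
    then show "\<forall>\<^sub>F k in sequentially. \<bar>z c (1 / real (Suc k)) - z c r\<bar> \<le> H * r powr \<beta>"
      by eventually_elim (auto intro: zH)
  qed simp
  define G where "G = H * 2 powr \<beta> + D * 2 powr \<beta> + H"
  have G: "0 < G" using H D by (auto simp: G_def intro!: add_pos_pos)
  \<comment> \<open>The detour through the ball around \<open>x\<close> of radius
    \<open>2 * r\<close> allows a change of centre. It is used with \<open>r\<close> equal to the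
    distance of two points for the Hoelder bound, and with a fixed ball for the comparison with
    \<open>b\<close>.\<close>
  have cross: "\<bar>b' x - z y r\<bar> \<le> (H * 2 powr \<beta> + D * 2 powr \<beta>) * r powr \<beta>" if "0 < r" "dist x y \<le> r" for x y r
  proof -
    have "ball y r \<subseteq> ball x (2 * r)"
      using that by (simp add: ball_subset_ball_iff dist_commute)
    then have "\<bar>z y r - z x (2 * r)\<bar> \<le> D * (2 * r) powr \<beta>"
      using that by (intro close) auto
    moreover have "\<bar>b' x - z x (2 * r)\<bar> \<le> H * (2 * r) powr \<beta>" using that by (intro b'z) auto
    ultimately show ?thesis using that by (simp add: powr_mult algebra_simps)
  qed
  have lip: "\<bar>b' x - b' y\<bar> \<le> G * norm (x - y) powr \<beta>" for x y
  proof (cases "x = y")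
    case False
    then have "\<bar>b' x - z y (norm (x - y))\<bar> \<le> (H * 2 powr \<beta> + D * 2 powr \<beta>) * norm (x - y) powr \<beta>"
      by (intro cross) (auto simp: dist_norm)
    moreover have "\<bar>b' y - z y (norm (x - y))\<bar> \<le> H * norm (x - y) powr \<beta>"
      using False by (intro b'z) auto
    ultimately show ?thesis by (simp add: G_def algebra_simps)
  qed simp
  \<comment> \<open>Continuity is wanted for the measurability of \<open>b'\<close> in the a.e.
    comparison.\<close>
  have "continuous_on UNIV b'"
    unfolding continuous_on_def
  proof
    fix x :: "real ^ 'n"
    have "((\<lambda>y. G * norm (y - x) powr \<beta>) \<longlongrightarrow> G * norm (x - x) powr \<beta>) (at x)"
      using \<open>0 < \<beta>\<close> by (intro tendsto_mult tendsto_powr' tendsto_norm tendsto_diff tendsto_const tendsto_ident_at) auto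
    then have "((\<lambda>y. G * norm (y - x) powr \<beta>) \<longlongrightarrow> 0) (at x)" by simp
    moreover have "\<forall>\<^sub>F y in at x. norm (b' y - b' x) \<le> G * norm (y - x) powr \<beta>"
      using lip by (simp add: always_eventually)
    ultimately have "((\<lambda>y. b' y - b' x) \<longlongrightarrow> 0) (at x)"
      by (rule Lim_null_comparison[rotated])
    then show "(b' \<longlongrightarrow> b' x) (at x within UNIV)" by (rule LIM_zero_cancel)
  qed
  then have b'm [measurable]: "b' \<in> borel_measurable lebesgue"
    by (intro measurable_completion) (simp add: borel_measurable_continuous_onI)
  have diff: "(\<integral>\<^sup>+y\<in>ball c r. ennreal \<bar>b y - b' y\<bar> \<partial>lebesgue) \<le> ennreal ((A + G) * r powr \<beta> * measure lebesgue (ball c r))"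
    if r: "0 < r" for c r
  proof -
    have pt: "\<bar>b y - b' y\<bar> \<le> \<bar>b y - z c r\<bar> + G * r powr \<beta>" if "y \<in> ball c r" for y
    proof -
      have "\<bar>b' y - z c r\<bar> \<le> (H * 2 powr \<beta> + D * 2 powr \<beta>) * r powr \<beta>"
        using that r by (intro cross) (auto simp: dist_commute)
      moreover have "0 \<le> H * r powr \<beta>" using H by simp
      ultimately show ?thesis by (simp add: G_def algebra_simps)
    qed
    have "(\<integral>\<^sup>+y\<in>ball c r. ennreal \<bar>b y - b' y\<bar> \<partial>lebesgue)
       \<le> (\<integral>\<^sup>+y. ennreal \<bar>b y - z c r\<bar> * indicator (ball c r) y + ennreal (G * r powr \<beta>) * indicator (ball c r) y \<partial>lebesgue)"
      using pt G by (intro nn_integral_mono) (auto simp: indicator_def simp flip: ennreal_plus intro!: ennreal_leI)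
    also have "\<dots> = (\<integral>\<^sup>+y\<in>ball c r. ennreal \<bar>b y - z c r\<bar> \<partial>lebesgue) + ennreal (G * r powr \<beta>) * emeasure lebesgue (ball c r)"
      by (subst nn_integral_add) (auto simp: nn_integral_cmult_indicator)
    also have "\<dots> \<le> ennreal (A * r powr \<beta> * (V * r ^ CARD('n))) + ennreal (G * r powr \<beta>) * ennreal (V * r ^ CARD('n))"
      unfolding meas[OF r] using z r by (intro add_right_mono) auto
    also have "\<dots> = ennreal ((A + G) * r powr \<beta> * (V * r ^ CARD('n)))"
      using \<open>0 < A\<close> G V r by (simp add: algebra_simps flip: ennreal_plus ennreal_mult)
    finally show ?thesis unfolding meas[OF r] .
  qed
  have "AE x in lebesgue. b x = b' x"
    using \<open>0 < \<beta>\<close> \<open>0 < A\<close> G diff by (intro AE_eq_of_set_nn_integral_ball_le[of b b' \<beta> "A + G"]) auto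
  then show ?thesis using lip unfolding lipschitz_space_def by blast
qed

text \<open>
  Measurability matters here: \<^const>\<open>emeasure\<close> is \<open>0\<close> on non-measurable sets, so the weak norm says
  nothing about a non-measurable level set. By Fatou's lemma, balls with centre in a countable dense
  set and rational radius exhaust the supremum.
\<close>

lemma frac_max_commutator_measurable:
  fixes b f :: "real ^ 'n \<Rightarrow> real"
  assumes b [measurable]: "b \<in> borel_measurable lebesgue"
    and f [measurable]: "f \<in> borel_measurable lebesgue"
    and \<alpha>: "\<alpha> \<le> real CARD('n)"
  shows "frac_max_commutator b \<alpha> f \<in> borel_measurable lebesgue"
proof -
  obtain D :: "(real ^ 'n) set" where D: "countable D" "\<And>X. open X \<Longrightarrow> X \<noteq> {} \<Longrightarrow> \<exists>d\<in>D. d \<in> X"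
    using countable_dense_setE by blast
  define e where "e = - 1 + \<alpha> / real CARD('n)"
  \<comment> \<open>With a nonpositive exponent, shrinking a ball can only increase its weight, so
    approximation from inside suffices.\<close>
  have e: "e \<le> 0" using \<alpha> by (simp add: e_def field_simps)
  define F where "F B x = ennreal (measure lebesgue B powr e) *
        (\<integral>\<^sup>+ y\<in>B. ennreal (\<bar>b x - b y\<bar> * \<bar>f y\<bar>) \<partial>lebesgue)" for B x
  define S where "S x = (SUP p\<in>D \<times> \<rat>. F (ball (fst p) (snd p)) x * indicator (ball (fst p) (snd p)) x)" for x
  have M: "frac_max_commutator b \<alpha> f x = (SUP B\<in>{ball c r | c r. x \<in> ball c r}. F B x)" for x
    unfolding frac_max_commutator_def F_def e_def ..
  have [measurable]: "ball c r \<in> sets lebesgue" for c :: "real ^ 'n" and r by simp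
  have le: "F (ball c r) x \<le> S x" if x: "x \<in> ball c r" for x c r
  proof -
    have "\<exists>d\<in>D. d \<in> ball c (1 / real (Suc k))" for k
      by (rule D(2)) auto
    then obtain ck where ck: "\<And>k. ck k \<in> D" "\<And>k. dist c (ck k) < 1 / real (Suc k)"
      by (metis mem_ball)
    \<comment> \<open>The upper bound keeps the ball around the displaced centre inside
      \<open>ball c r\<close>; the lower bound makes every point of \<open>ball c r\<close> lie in
      all late balls.\<close>
    have "\<exists>q\<in>\<rat>. r - 2 * (1 / real (Suc k)) < q \<and> q < r - 1 / real (Suc k)" for k
      by (rule Rats_dense_in_real) (simp add: field_simps)
    then obtain q where q: "\<And>k. q k \<in> \<rat>" "\<And>k. r - 2 * (1 / real (Suc k)) < q k" "\<And>k. q k < r - 1 / real (Suc k)"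
      by metis
    define B where "B k = ball (ck k) (q k)" for k
    have sub: "B k \<subseteq> ball c r" for k
      unfolding B_def ball_subset_ball_iff using ck(2)[of k] q(3)[of k] by (simp add: dist_commute)
    have ev: "eventually (\<lambda>k. y \<in> B k) sequentially" if "y \<in> ball c r" for y
    proof -
      have "eventually (\<lambda>k. 1 / real (Suc k) < (r - dist c y) / 3) sequentially"
        using that order_tendstoD(2)[OF LIMSEQ_inverse_real_of_nat, of "(r - dist c y) / 3"]
        by (simp add: inverse_eq_divide)
      then show ?thesis
      proof eventually_elim
        case (elim k)
        then have "3 * (1 / real (Suc k)) < r - dist c y" by simp
        moreover have "dist (ck k) y < 1 / real (Suc k) + dist c y"
          using ck(2)[of k] dist_triangle[of "ck k" y c] by (simp add: dist_commute)
        ultimately have "dist (ck k) y < q k" using q(2)[of k] by linarith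
        then show ?case by (simp add: B_def)
      qed
    qed
    define h where "h y = ennreal (\<bar>b x - b y\<bar> * \<bar>f y\<bar>)" for y
    have [measurable]: "h \<in> borel_measurable lebesgue" unfolding h_def by measurable
    have [measurable]: "B k \<in> sets lebesgue" for k by (simp add: B_def)
    define v where "v = measure lebesgue (ball c r)"
    have "0 < r" using x zero_le_dist[of c x] unfolding mem_ball by linarith
    then have v: "0 < v" by (simp add: v_def content_ball)
    \<comment> \<open>Only late \<open>k\<close> qualify: the indicator in \<open>S\<close> discards
      balls that miss \<open>x\<close>.\<close>
    have "eventually (\<lambda>k. (\<integral>\<^sup>+y\<in>B k. h y \<partial>lebesgue) \<le> ennreal (v powr (- e)) * S x) sequentially"
      using ev[OF x]
    proof eventually_elim
      case (elim k)
      then have "0 < q k" using zero_le_dist[of "ck k" x] unfolding mem_ball B_def by linarith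
      then have vk: "0 < measure lebesgue (B k)" by (simp add: B_def content_ball)
      moreover have "measure lebesgue (B k) \<le> v"
        unfolding v_def B_def using sub[of k] by (intro measure_mono_fmeasurable) (auto simp: B_def)
      ultimately have "v powr e \<le> measure lebesgue (B k) powr e"
        using e by (intro powr_mono2') auto
      then have "ennreal (v powr e) * (\<integral>\<^sup>+y\<in>B k. h y \<partial>lebesgue) \<le> F (B k) x"
        unfolding F_def h_def by (intro mult_right_mono ennreal_leI) auto
      also have "\<dots> = F (ball (fst (ck k, q k)) (snd (ck k, q k))) x * indicator (ball (fst (ck k, q k)) (snd (ck k, q k))) x"
        using elim by (simp add: B_def)
      also have "\<dots> \<le> S x"
        unfolding S_def using ck q by (intro SUP_upper) auto
      finally have "ennreal (v powr (- e)) * (ennreal (v powr e) * (\<integral>\<^sup>+y\<in>B k. h y \<partial>lebesgue)) \<le> ennreal (v powr (- e)) * S x"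
        by (rule mult_left_mono) simp
      then show ?case
        using v by (simp add: mult.assoc[symmetric] powr_add[symmetric] flip: ennreal_mult)
    qed
    then have "liminf (\<lambda>k. \<integral>\<^sup>+y\<in>B k. h y \<partial>lebesgue) \<le> ennreal (v powr (- e)) * S x"
      by (rule Liminf_le[rotated]) simp
    moreover have "(\<integral>\<^sup>+y\<in>ball c r. h y \<partial>lebesgue) \<le> (\<integral>\<^sup>+y. liminf (\<lambda>k. h y * indicator (B k) y) \<partial>lebesgue)"
    proof (rule nn_integral_mono)
      fix y
      show "h y * indicator (ball c r) y \<le> liminf (\<lambda>k. h y * indicator (B k) y)"
      proof (cases "y \<in> ball c r")
        case True
        have "eventually (\<lambda>k. h y * indicator (ball c r) y \<le> h y * indicator (B k) y) sequentially"
          using ev[OF True] by eventually_elim (use True in simp)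
        then show ?thesis by (rule Liminf_bounded)
      qed simp
    qed
    moreover have "\<dots> \<le> liminf (\<lambda>k. \<integral>\<^sup>+y\<in>B k. h y \<partial>lebesgue)"
      by (rule nn_integral_liminf) measurable
    ultimately have "(\<integral>\<^sup>+y\<in>ball c r. h y \<partial>lebesgue) \<le> ennreal (v powr (- e)) * S x"
      by (meson order_trans)
    then have "F (ball c r) x \<le> ennreal (v powr e) * (ennreal (v powr (- e)) * S x)"
      unfolding F_def h_def v_def[symmetric] by (rule mult_left_mono) simp
    then show ?thesis
      using v by (simp add: mult.assoc[symmetric] powr_add[symmetric] flip: ennreal_mult)
  qed
  have "S x \<le> frac_max_commutator b \<alpha> f x" for x
    unfolding S_def M
  proof (rule SUP_least)
    fix p :: "(real ^ 'n) \<times> real"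
    show "F (ball (fst p) (snd p)) x * indicator (ball (fst p) (snd p)) x
      \<le> (SUP B\<in>{ball c r | c r. x \<in> ball c r}. F B x)"
    proof (cases "x \<in> ball (fst p) (snd p)")
      case True
      then have "F (ball (fst p) (snd p)) x \<le> (SUP B\<in>{ball c r | c r. x \<in> ball c r}. F B x)"
        by (intro SUP_upper) blast
      with True show ?thesis by simp
    qed simp
  qed
  moreover have "frac_max_commutator b \<alpha> f x \<le> S x" for x
    unfolding M by (rule SUP_least) (use le in auto)
  ultimately have "frac_max_commutator b \<alpha> f = S"
    by (intro ext antisym)
  moreover have Fm: "F (ball c r) \<in> borel_measurable lebesgue" for c r
  proof -
    \<comment> \<open>In the integration variable \<open>b\<close> and \<open>f\<close> are replaced
      by Borel representatives, so the parameter integral is measurable by the product rule for the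
      sigma-finite \<open>lborel\<close>. The outer \<open>b x\<close> stays as it is.\<close>
    obtain b0 where b0 [measurable]: "b0 \<in> borel_measurable lborel" and b0e: "AE x in lborel. b x = b0 x"
      using completion_ex_borel_measurable_real[OF b] by blast
    obtain f0 where f0 [measurable]: "f0 \<in> borel_measurable lborel" and f0e: "AE x in lborel. f x = f0 x"
      using completion_ex_borel_measurable_real[OF f] by blast
    have "(\<integral>\<^sup>+ y\<in>ball c r. ennreal (\<bar>b x - b y\<bar> * \<bar>f y\<bar>) \<partial>lebesgue)
       = (\<integral>\<^sup>+ y\<in>ball c r. ennreal (\<bar>b x - b0 y\<bar> * \<bar>f0 y\<bar>) \<partial>lborel)" for x
      unfolding nn_integral_completion
      using b0e f0e by (intro nn_integral_cong_AE, eventually_elim) simp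
    then have "F (ball c r) = (\<lambda>x. ennreal (measure lebesgue (ball c r) powr e) *
        (\<integral>\<^sup>+ y\<in>ball c r. ennreal (\<bar>b x - b0 y\<bar> * \<bar>f0 y\<bar>) \<partial>lborel))"
      by (simp add: F_def fun_eq_iff del: nn_integral_completion)
    also have "\<dots> \<in> borel_measurable lebesgue"
    proof (intro borel_measurable_times_ennreal borel_measurable_const lborel.borel_measurable_nn_integral)
      have b0': "b0 \<in> borel_measurable lborel" and f0': "f0 \<in> borel_measurable lborel"
        and B: "ball c r \<in> sets lborel" using b0 f0 by simp_all
      show "(\<lambda>(x, y). ennreal (\<bar>b x - b0 y\<bar> * \<bar>f0 y\<bar>) * indicator (ball c r) y)
          \<in> borel_measurable (lebesgue \<Otimes>\<^sub>M lborel)"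
        unfolding case_prod_beta
        by (intro borel_measurable_times_ennreal measurable_compose[OF _ measurable_ennreal]
            borel_measurable_times borel_measurable_abs borel_measurable_diff
            measurable_compose[OF measurable_fst b] measurable_compose[OF measurable_snd b0']
            measurable_compose[OF measurable_snd f0']
            measurable_compose[OF measurable_snd borel_measurable_indicator[OF B]])
    qed
    finally show ?thesis .
  qed
  have "S \<in> borel_measurable lebesgue"
    unfolding S_def
    using D(1) by (intro borel_measurable_SUP borel_measurable_times_ennreal borel_measurable_indicator Fm)
      (simp_all add: countable_rat)
  ultimately show ?thesis by simp
qed

section \<open>Testing on indicator functions of balls\<close>

lemma indicator_ball_mem_L1_loc: "indicat_real (ball c r) \<in> (L1_loc :: (real ^ 'n \<Rightarrow> real) set)"
proof -
  have "integrable lebesgue (indicat_real (K \<inter> ball c r))" if "compact K" for K :: "(real ^ 'n) set"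
  proof -
    have "K \<inter> ball c r \<in> lmeasurable"
      using that by (intro fmeasurable_Int_fmeasurable lmeasurable_compact) auto
    then show ?thesis by (simp add: integrable_indicator_iff fmeasurable_def del: emeasure_completion)
  qed
  then show ?thesis
    by (auto simp: L1_loc_def set_integrable_def indicator_inter_arith[symmetric])
qed

text \<open>The integral at scale \<open>l\<close> is \<open>\<Phi> (1 / l) * v\<close>. The factor
  2 in \<open>l\<close> puts \<open>1 / l\<close> strictly below the inverse at
  \<open>1 / v\<close>, where \<Phi> is at most \<open>1 / v\<close>.\<close>

lemma orlicz_indicator_ball:
  fixes c :: "real ^ 'n"
  assumes Y: "young_function \<Phi>" and v: "v = measure lebesgue (ball c r)" "0 < v"
  defines "l \<equiv> 2 / young_inverse \<Phi> (1 / v)"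
  shows "indicat_real (ball c r) \<in> orlicz_space \<Phi>"
    and "orlicz_norm \<Phi> (indicat_real (ball c r)) \<le> ennreal l"
proof -
  have pos: "0 < young_inverse \<Phi> (1 / v)" using young_inverse_pos[OF Y] v by simp
  then have l: "0 < l" by (simp add: l_def)
  have "(\<integral>\<^sup>+ x. \<Phi> (\<bar>indicat_real (ball c r) x\<bar> / l) \<partial>lebesgue)
      = (\<integral>\<^sup>+ x. \<Phi> (1 / l) * indicator (ball c r) x \<partial>lebesgue)"
    using Y by (intro nn_integral_cong) (auto simp: indicator_def young_function_def)
  also have "\<dots> = \<Phi> (1 / l) * ennreal v"
  proof -
    have "emeasure lebesgue (ball c r) = ennreal v"
      unfolding v by (intro emeasure_eq_measure2 fmeasurableD2) auto
    then show ?thesis by (simp add: nn_integral_cmult_indicator)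
  qed
  also have "\<dots> \<le> ennreal (1 / v) * ennreal v"
    using pos by (intro mult_right_mono[OF le_of_less_young_inverse]) (auto simp: l_def)
  also have "\<dots> = 1" using v by (simp flip: ennreal_mult)
  finally have one: "(\<integral>\<^sup>+ x. \<Phi> (\<bar>indicat_real (ball c r) x\<bar> / l) \<partial>lebesgue) \<le> 1" .
  then show "orlicz_norm \<Phi> (indicat_real (ball c r)) \<le> ennreal l"
    unfolding orlicz_norm_def using l by (intro Inf_lower imageI) auto
  have "(\<integral>\<^sup>+ x. \<Phi> (1 / l * \<bar>indicat_real (ball c r) x\<bar>) \<partial>lebesgue) < \<infinity>"
    using order_le_less_trans[OF one, of \<infinity>] by simp
  then show "indicat_real (ball c r) \<in> orlicz_space \<Phi>"
    unfolding orlicz_space_def using l indicator_ball_mem_L1_loc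
    by (auto intro!: exI[of _ "1 / l"])
qed

lemma bounded_orlicz_to_weak_imp_mean_oscillation:
  fixes b :: "real ^ 'n \<Rightarrow> real"
  assumes \<Phi>: "young_function \<Phi>" and \<Psi>: "young_function \<Psi>"
    and b [measurable]: "b \<in> borel_measurable lebesgue"
    and \<alpha>: "\<alpha> \<le> real CARD('n)" and "0 < C"
    and inv: "\<And>t. 0 < t \<Longrightarrow> young_inverse \<Psi> t
        \<le> C * young_inverse \<Phi> t * t powr (- ((\<alpha> + \<beta>) / real CARD('n)))"
    and bd: "bounded_orlicz_to_weak \<Phi> \<Psi> (frac_max_commutator b \<alpha>)"
  obtains A where "0 < A" "\<And>c r. 0 < r \<Longrightarrow> \<exists>z. (\<integral>\<^sup>+y\<in>ball c r. ennreal \<bar>b y - z\<bar> \<partial>lebesgue)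
                \<le> ennreal (A * r powr \<beta> * measure lebesgue (ball c r))"
proof -
  obtain K0 where K0: "\<And>f. f \<in> orlicz_space \<Phi> \<Longrightarrow>
      weak_orlicz_norm \<Psi> (frac_max_commutator b \<alpha> f) \<le> ennreal K0 * orlicz_norm \<Phi> f"
    using bd unfolding bounded_orlicz_to_weak_def by blast
  define K where "K = max 1 K0"
  have K: "0 < K" "K0 \<le> K" by (auto simp: K_def)
  define V where "V = unit_ball_vol (real CARD('n))"
  have V: "0 < V" by (simp add: V_def)
  define n where "n = real CARD('n)"
  have n: "0 < n" by (simp add: n_def)
  \<comment> \<open>The 8 is a product of three factors 2: from the norm of the indicator, from the
    slack in choosing \<open>l\<close>, and from \<open>T\<close>. The power of \<open>V\<close>
    converts volume into radius.\<close>
  define A where "A = 8 * K * C * V powr (\<beta> / n)"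
  have A: "0 < A" using K \<open>0 < C\<close> V by (simp add: A_def)
  have main: "\<exists>z. (\<integral>\<^sup>+y\<in>ball c r. ennreal \<bar>b y - z\<bar> \<partial>lebesgue)
      \<le> ennreal (A * r powr \<beta> * measure lebesgue (ball c r))" if r: "0 < r" for c r
  proof -
    define B where "B = ball c r"
    define v where "v = measure lebesgue B"
    have v: "v = V * r ^ CARD('n)" "0 < v" "emeasure lebesgue B = ennreal v"
      using r V by (simp_all add: v_def B_def content_ball emeasure_ball V_def)
    define f where "f = indicat_real B"
    have fm: "f \<in> borel_measurable lebesgue" unfolding f_def B_def by (intro borel_measurable_indicator) simp
    define \<phi> where "\<phi> = young_inverse \<Phi> (1 / v)"
    have \<phi>: "0 < \<phi>" using young_inverse_pos[OF \<Phi>] v(2) by (simp add: \<phi>_def)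
    have f: "f \<in> orlicz_space \<Phi>" "orlicz_norm \<Phi> f \<le> ennreal (2 / \<phi>)"
      using orlicz_indicator_ball[OF \<Phi> v_def[unfolded B_def] v(2)] by (simp_all add: f_def B_def \<phi>_def)
    have "weak_orlicz_norm \<Psi> (frac_max_commutator b \<alpha> f) \<le> ennreal K0 * orlicz_norm \<Phi> f"
      by (rule K0[OF f(1)])
    also have "\<dots> \<le> ennreal K * ennreal (2 / \<phi>)"
      using f(2) K by (intro mult_mono ennreal_leI) auto
    also have "\<dots> = ennreal (K * (2 / \<phi>))"
      using K \<phi> by (intro ennreal_mult[symmetric]) auto
    \<comment> \<open>Strict slack is needed to extract an admissible \<open>l\<close> from the
      infimum.\<close>
    also have "\<dots> < ennreal (2 * K * (2 / \<phi>))"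
      using K \<phi> by (intro ennreal_lessI) (auto simp: field_simps)
    finally obtain l where l: "0 < l" "l < 2 * K * (2 / \<phi>)"
      and sup: "(SUP t\<in>{0<..}. \<Psi> t * emeasure lebesgue {x. ennreal t < frac_max_commutator b \<alpha> f x / ennreal l}) \<le> 1"
      unfolding weak_orlicz_norm_def Inf_less_iff using K \<phi> by (auto simp: ennreal_less_iff)
    define T where "T = 2 * young_inverse \<Psi> (1 / v)"
    have pos: "0 < young_inverse \<Psi> (1 / v)" using young_inverse_pos[OF \<Psi>] v(2) by simp
    then have T: "0 < T" "ennreal (1 / v) < \<Psi> T"
      by (auto simp: T_def intro!: less_of_young_inverse_less[OF \<Psi>])
    define S where "S = {x. ennreal T < frac_max_commutator b \<alpha> f x / ennreal l}"
    have [measurable]: "frac_max_commutator b \<alpha> f \<in> borel_measurable lebesgue"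
      by (rule frac_max_commutator_measurable[OF b fm \<alpha>])
    have "{x \<in> space lebesgue. ennreal T < frac_max_commutator b \<alpha> f x / ennreal l} \<in> sets lebesgue"
      by measurable
    then have Sm: "S \<in> sets lebesgue" by (simp add: S_def)
    have S1: "\<Psi> T * emeasure lebesgue S \<le> 1"
      unfolding S_def by (rule order_trans[OF SUP_upper sup]) (use T in auto)
    \<comment> \<open>Otherwise monotonicity, which needs \<open>S\<close> measurable, would give
      \<open>\<Psi> T * v \<le> 1\<close> against the choice of \<open>T\<close>. The value of
      \<open>b\<close> at a point of \<open>B\<close> outside \<open>S\<close> becomes the
      approximating constant.\<close>
    have "\<not> B \<subseteq> S"
    proof
      assume "B \<subseteq> S"
      then have "ennreal v \<le> emeasure lebesgue S"
        using emeasure_mono[OF _ Sm] unfolding v(3)[symmetric] by blast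
      then have "\<Psi> T * ennreal v \<le> 1"
        by (intro order_trans[OF mult_left_mono S1]) auto
      then have "\<Psi> T * ennreal v * ennreal (1 / v) \<le> 1 * ennreal (1 / v)"
        by (rule mult_right_mono) simp
      then have "\<Psi> T \<le> ennreal (1 / v)"
        using v(2) by (simp add: mult.assoc flip: ennreal_mult)
      with T(2) show False by simp
    qed
    then obtain x where x: "x \<in> B" "x \<notin> S" by blast
    have "frac_max_commutator b \<alpha> f x / ennreal l \<le> ennreal T"
      using x(2) by (simp add: S_def not_less)
    then have "frac_max_commutator b \<alpha> f x / ennreal l * ennreal l \<le> ennreal T * ennreal l"
      by (rule mult_right_mono) simp
    then have Mx: "frac_max_commutator b \<alpha> f x \<le> ennreal (T * l)"
      using l(1) T by (simp add: ennreal_divide_times ennreal_mult ennreal_mult_divide_eq mult_divide_eq_ennreal)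
    define J where "J = (\<integral>\<^sup>+y\<in>B. ennreal \<bar>b y - b x\<bar> \<partial>lebesgue)"
    have "J = (\<integral>\<^sup>+ y\<in>B. ennreal (\<bar>b x - b y\<bar> * \<bar>f y\<bar>) \<partial>lebesgue)"
      unfolding J_def by (intro nn_integral_cong) (auto simp: f_def indicator_def abs_minus_commute)
    then have "ennreal (v powr (- 1 + \<alpha> / n)) * J \<le> frac_max_commutator b \<alpha> f x"
      unfolding frac_max_commutator_def v_def n_def
      by (intro SUP_upper2[of B]) (use x(1) in \<open>auto simp: B_def\<close>)
    then have "ennreal (v powr (1 - \<alpha> / n)) * (ennreal (v powr (- 1 + \<alpha> / n)) * J) \<le> ennreal (v powr (1 - \<alpha> / n)) * ennreal (T * l)"
      using Mx by (intro mult_left_mono) auto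
    also have "ennreal (v powr (1 - \<alpha> / n)) * (ennreal (v powr (- 1 + \<alpha> / n)) * J) = J"
      using v(2) by (simp add: mult.assoc[symmetric] powr_add[symmetric] flip: ennreal_mult)
    also have "ennreal (v powr (1 - \<alpha> / n)) * ennreal (T * l) = ennreal (v powr (1 - \<alpha> / n) * (T * l))"
      using T l by (simp add: ennreal_mult)
    finally have J: "J \<le> ennreal (v powr (1 - \<alpha> / n) * (T * l))" .
    have "T * l \<le> T * (2 * K * (2 / \<phi>))"
      using T l by (intro mult_left_mono) auto
    \<comment> \<open>The comparison of inverses at \<open>1 / v\<close> introduces a factor
      \<open>\<phi>\<close>, which cancels against the norm of the indicator and leaves a power of
      the volume.\<close>
    also have "\<dots> \<le> 2 * (C * \<phi> * (1 / v) powr (- ((\<alpha> + \<beta>) / n))) * (2 * K * (2 / \<phi>))"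
      unfolding T_def \<phi>_def n_def using inv[of "1 / v"] v(2) K \<phi>[unfolded \<phi>_def]
      by (intro mult_right_mono mult_left_mono) auto
    also have "\<dots> = 8 * K * C * v powr ((\<alpha> + \<beta>) / n)"
      using \<phi> v(2) by (simp add: powr_minus powr_divide)
    finally have "v powr (1 - \<alpha> / n) * (T * l) \<le> v powr (1 - \<alpha> / n) * (8 * K * C * v powr ((\<alpha> + \<beta>) / n))"
      by (intro mult_left_mono) auto
    also have "\<dots> = 8 * K * C * v powr (1 - \<alpha> / n + (\<alpha> + \<beta>) / n)"
      by (simp add: powr_add)
    also have "1 - \<alpha> / n + (\<alpha> + \<beta>) / n = \<beta> / n + 1" by (simp add: add_divide_distrib)
    also have "v powr (\<beta> / n + 1) = v powr (\<beta> / n) * v" using v(2) by (simp add: powr_add)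
    also have "v powr (\<beta> / n) = V powr (\<beta> / n) * r powr \<beta>"
      using V r n by (simp add: v(1) powr_mult powr_realpow[symmetric] powr_powr n_def)
    also have "8 * K * C * (V powr (\<beta> / n) * r powr \<beta> * v) = A * r powr \<beta> * v"
      by (simp add: A_def)
    finally have "J \<le> ennreal (A * r powr \<beta> * v)"
      by (intro order_trans[OF J ennreal_leI])
    then show ?thesis unfolding J_def v_def B_def by blast
  qed
  show thesis using that[OF A main] .
qed

section \<open>The characterization\<close>

theorem theorem4p9:
  fixes \<alpha> \<beta> :: real
    and b :: "real ^ 'n \<Rightarrow> real"
    and \<Phi> \<Psi> :: "real \<Rightarrow> ennreal"
  assumes "0 < \<beta>" and "\<beta> < 1"
    and "0 \<le> \<alpha>" and "\<alpha> < real CARD('n)"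
    and "0 < \<alpha> + \<beta>" and "\<alpha> + \<beta> < real CARD('n)"
    and "b \<in> L1_loc"
    and "young_function \<Phi>" and "young_function \<Psi>" and "\<Phi> \<in> young_class_Y"
  shows
    "((\<exists>C>0. \<forall>t>0. t powr (- ((\<alpha> + \<beta>) / real CARD('n))) * young_inverse \<Phi> t
                     \<le> C * young_inverse \<Psi> t)
      \<longrightarrow> (b \<in> lipschitz_space \<beta> \<longrightarrow>
           bounded_orlicz_to_weak \<Phi> \<Psi> (frac_max_commutator b \<alpha>)))
   \<and> ((\<exists>C>0. \<forall>t>0. young_inverse \<Psi> t
                     \<le> C * young_inverse \<Phi> t * t powr (- ((\<alpha> + \<beta>) / real CARD('n)))) \<and>
      (\<exists>\<epsilon>>0. almost_decreasing (\<lambda>t. ennreal (t powr (1 + \<epsilon>)) / \<Psi> t))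
      \<longrightarrow> (bounded_orlicz_to_weak \<Phi> \<Psi> (frac_max_commutator b \<alpha>) \<longrightarrow>
           b \<in> lipschitz_space \<beta>))
   \<and> ((\<exists>C1>0. \<exists>C2>0. \<forall>t>0.
         C1 * young_inverse \<Phi> t * t powr (- ((\<alpha> + \<beta>) / real CARD('n))) \<le> young_inverse \<Psi> t \<and>
         young_inverse \<Psi> t \<le> C2 * young_inverse \<Phi> t * t powr (- ((\<alpha> + \<beta>) / real CARD('n)))) \<and>
      (\<exists>\<epsilon>>0. almost_decreasing (\<lambda>t. ennreal (t powr (1 + \<epsilon>)) / \<Psi> t))
      \<longrightarrow> (b \<in> lipschitz_space \<beta> \<longleftrightarrow>
           bounded_orlicz_to_weak \<Phi> \<Psi> (frac_max_commutator b \<alpha>)))"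
proof -
  note Y = \<open>young_function \<Phi>\<close> \<open>young_function \<Psi>\<close>
  have suff: "bounded_orlicz_to_weak \<Phi> \<Psi> (frac_max_commutator b \<alpha>)"
    if "b \<in> lipschitz_space \<beta>" "0 < C"
      "\<forall>t>0. t powr (- ((\<alpha> + \<beta>) / real CARD('n))) * young_inverse \<Phi> t \<le> C * young_inverse \<Psi> t" for C
    using that assms
    by (intro lipschitz_imp_bounded_orlicz_to_weak[of \<Phi> \<Psi> \<beta> \<alpha> C b]) auto
  have nec: "b \<in> lipschitz_space \<beta>"
    if bd: "bounded_orlicz_to_weak \<Phi> \<Psi> (frac_max_commutator b \<alpha>)" and "0 < C"
      and inv: "\<forall>t>0. young_inverse \<Psi> t
        \<le> C * young_inverse \<Phi> t * t powr (- ((\<alpha> + \<beta>) / real CARD('n)))" for C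
  proof -
    have b: "b \<in> borel_measurable lebesgue"
      using \<open>b \<in> L1_loc\<close> by (rule L1_loc_borel_measurable)
    obtain A where A: "0 < A" "\<And>c r. 0 < r \<Longrightarrow> \<exists>z. (\<integral>\<^sup>+y\<in>ball c r. ennreal \<bar>b y - z\<bar> \<partial>lebesgue)
                \<le> ennreal (A * r powr \<beta> * measure lebesgue (ball c r))"
      using bounded_orlicz_to_weak_imp_mean_oscillation[OF Y b less_imp_le[OF \<open>\<alpha> < real CARD('n)\<close>] \<open>0 < C\<close> _ bd, of \<beta>]
        inv by blast
    show ?thesis
      by (rule lipschitz_space_of_mean_oscillation[OF b \<open>0 < \<beta>\<close> A])
  qed
  have lower: "t powr (- ((\<alpha> + \<beta>) / real CARD('n))) * young_inverse \<Phi> t \<le> 1 / C1 * young_inverse \<Psi> t"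
    if "0 < C1" "C1 * young_inverse \<Phi> t * t powr (- ((\<alpha> + \<beta>) / real CARD('n))) \<le> young_inverse \<Psi> t" for C1 t
    using that by (simp add: field_simps)
  show ?thesis
  proof (intro conjI impI)
    assume "\<exists>C>0. \<forall>t>0. t powr (- ((\<alpha> + \<beta>) / real CARD('n))) * young_inverse \<Phi> t
                     \<le> C * young_inverse \<Psi> t" and "b \<in> lipschitz_space \<beta>"
    then show "bounded_orlicz_to_weak \<Phi> \<Psi> (frac_max_commutator b \<alpha>)" using suff by blast
  next
    assume "(\<exists>C>0. \<forall>t>0. young_inverse \<Psi> t
                     \<le> C * young_inverse \<Phi> t * t powr (- ((\<alpha> + \<beta>) / real CARD('n)))) \<and>
      (\<exists>\<epsilon>>0. almost_decreasing (\<lambda>t. ennreal (t powr (1 + \<epsilon>)) / \<Psi> t))"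
      and "bounded_orlicz_to_weak \<Phi> \<Psi> (frac_max_commutator b \<alpha>)"
    then show "b \<in> lipschitz_space \<beta>" using nec by blast
  next
    assume "(\<exists>C1>0. \<exists>C2>0. \<forall>t>0.
         C1 * young_inverse \<Phi> t * t powr (- ((\<alpha> + \<beta>) / real CARD('n))) \<le> young_inverse \<Psi> t \<and>
         young_inverse \<Psi> t \<le> C2 * young_inverse \<Phi> t * t powr (- ((\<alpha> + \<beta>) / real CARD('n)))) \<and>
      (\<exists>\<epsilon>>0. almost_decreasing (\<lambda>t. ennreal (t powr (1 + \<epsilon>)) / \<Psi> t))"
    then obtain C1 C2 where C: "0 < C1" "0 < C2"
      "\<forall>t>0. C1 * young_inverse \<Phi> t * t powr (- ((\<alpha> + \<beta>) / real CARD('n))) \<le> young_inverse \<Psi> t"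
      "\<forall>t>0. young_inverse \<Psi> t \<le> C2 * young_inverse \<Phi> t * t powr (- ((\<alpha> + \<beta>) / real CARD('n)))"
      by blast
    show "b \<in> lipschitz_space \<beta> \<longleftrightarrow> bounded_orlicz_to_weak \<Phi> \<Psi> (frac_max_commutator b \<alpha>)"
    proof
      assume "b \<in> lipschitz_space \<beta>"
      then show "bounded_orlicz_to_weak \<Phi> \<Psi> (frac_max_commutator b \<alpha>)"
        using C(1,3) lower by (intro suff[of "1 / C1"]) auto
    next
      assume "bounded_orlicz_to_weak \<Phi> \<Psi> (frac_max_commutator b \<alpha>)"
      then show "b \<in> lipschitz_space \<beta>" using C(2,4) by (rule nec)
    qed
  qed
qed

end
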